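(* Let $p\in(0,1)$ and let $c$ be any constant satisfying $1<c<2^{1/p-1}$. Then for all large enough $n$ there exists a $p$-convex body $K\subset\mathbb{R}^n$ (which is a star body, so that $IK$ is defined) such that $$c^n\,d_{BM}(K,B_2^n)<d_{BM}(IK,B_2^n).$$
   Context: A body is a compact set with nonempty interior. For a body $K\subset\mathbb{R}^n$ that is star-shaped with respect to the origin, its Minkowski functional is $\|x\|_K=\min\{\lambda\ge 0: x\in\lambda K\}$ and its radial function is $\rho_K(u)=\max\{\lambda\ge 0:\lambda u\in K\}$ for $u\in S^{n-1}$, so $\rho_K(u)=\|u\|_K^{-1}$. $K$ is a star body if it is star-shaped at the origin and $\rho_K$ is positive and continuous on $S^{n-1}$. For $p\in(0,1]$, a body $K$ is $p$-convex if $\|x+y\|_K^p\le\|x\|_K^p+\|y\|_K^p$ for all $x,y\in\mathbb{R}^n$; equivalently, $t^{1/p}x+(1-t)^{1/p}y\in K$ whenever $x,y\in K$ and $t\in(0,1)$. The intersection body $IK$ of a star body $K$ in $\mathbb{R}^n$ is the star body with radial function $\rho_{IK}(u)=|K\cap u^\perp|$ for $u\in S^{n-1}$, where $u^\perp=\{x\in\mathbb{R}^n:x\cdot u=0\}$ and $|\cdot|$ is $(n-1)$-dimensional Lebesgue measure. $B_2^n$ is the closed Euclidean unit ball in $\mathbb{R}^n$. The Banach-Mazur distance between star bodies $K,L$ in $\mathbb{R}^n$ is $d_{BM}(K,L)=\inf\{b/a: a,b>0,\ \exists\,T\in GL(n)\text{ with } aK\subset TL\subset bK\}$. *)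

theory Defs
  imports "HOL-Analysis.Analysis"
begin

text \<open>
  The space \<open>\<real>\<^sup>n\<close> for a variable \<open>n\<close> is \<^term>\<open>Euclidean_space n\<close>: its points are the functions
  \<^typ>\<open>nat \<Rightarrow> real\<close> that vanish at all indices \<open>i \<ge> n\<close>.
\<close>

abbreviation Rn :: "nat \<Rightarrow> (nat \<Rightarrow> real) set" where
  "Rn n \<equiv> topspace (Euclidean_space n)"

definition vadd :: "(nat \<Rightarrow> real) \<Rightarrow> (nat \<Rightarrow> real) \<Rightarrow> (nat \<Rightarrow> real)" where
  "vadd x y = (\<lambda>i. x i + y i)"

definition vscale :: "real \<Rightarrow> (nat \<Rightarrow> real) \<Rightarrow> (nat \<Rightarrow> real)" where
  "vscale a x = (\<lambda>i. a * x i)"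

definition dot :: "nat \<Rightarrow> (nat \<Rightarrow> real) \<Rightarrow> (nat \<Rightarrow> real) \<Rightarrow> real" where
  "dot n x y = (\<Sum>i<n. x i * y i)"

definition unit_sphere :: "nat \<Rightarrow> (nat \<Rightarrow> real) set" where
  "unit_sphere n = {x \<in> Rn n. L2_set x {..<n} = 1}"

definition unit_ball :: "nat \<Rightarrow> (nat \<Rightarrow> real) set" where
  "unit_ball n = {x \<in> Rn n. L2_set x {..<n} \<le> 1}"

definition GL :: "nat \<Rightarrow> ((nat \<Rightarrow> real) \<Rightarrow> (nat \<Rightarrow> real)) set" where
  "GL n = {T. bij_betw T (Rn n) (Rn n) \<and>
      (\<forall>x\<in>Rn n. \<forall>y\<in>Rn n. T (vadd x y) = vadd (T x) (T y)) \<and>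
      (\<forall>a. \<forall>x\<in>Rn n. T (vscale a x) = vscale a (T x))}"

definition body :: "nat \<Rightarrow> (nat \<Rightarrow> real) set \<Rightarrow> bool" where
  "body n K \<longleftrightarrow> compactin (Euclidean_space n) K \<and> Euclidean_space n interior_of K \<noteq> {}"

definition star_shaped :: "(nat \<Rightarrow> real) set \<Rightarrow> bool" where
  "star_shaped K \<longleftrightarrow> (\<lambda>i. 0) \<in> K \<and> (\<forall>x\<in>K. \<forall>t\<in>{0..1}. vscale t x \<in> K)"

text \<open>
  For a star body the infimum and the supremum below are attained, so they are the
  minimum and the maximum.
\<close>

definition minkowski :: "(nat \<Rightarrow> real) set \<Rightarrow> (nat \<Rightarrow> real) \<Rightarrow> real" where
  "minkowski K x = Inf {l. 0 \<le> l \<and> x \<in> vscale l ` K}"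

definition radial :: "(nat \<Rightarrow> real) set \<Rightarrow> (nat \<Rightarrow> real) \<Rightarrow> real" where
  "radial K u = Sup {l. 0 \<le> l \<and> vscale l u \<in> K}"

definition star_body :: "nat \<Rightarrow> (nat \<Rightarrow> real) set \<Rightarrow> bool" where
  "star_body n K \<longleftrightarrow> body n K \<and> star_shaped K \<and>
     (\<forall>u\<in>unit_sphere n. 0 < radial K u) \<and>
     continuous_map (subtopology (Euclidean_space n) (unit_sphere n)) euclideanreal (radial K)"

definition p_convex :: "nat \<Rightarrow> real \<Rightarrow> (nat \<Rightarrow> real) set \<Rightarrow> bool" where
  "p_convex n p K \<longleftrightarrow> body n K \<and>
     (\<forall>x\<in>Rn n. \<forall>y\<in>Rn n.
        minkowski K (vadd x y) powr p \<le> minkowski K x powr p + minkowski K y powr p)"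

text \<open>
  Lebesgue measure on the hyperplane \<open>u\<^sup>\<bottom>\<close> is Lebesgue measure on \<open>\<real>\<^sup>n\<^sup>-\<^sup>1\<close> transported along
  an orthonormal basis of \<open>u\<^sup>\<bottom>\<close>. By rotation invariance the choice of the basis does not matter;
  one exists for every unit vector, as shown below. A family of \<open>n - 1\<close> orthonormal vectors
  of \<open>u\<^sup>\<bottom>\<close> is automatically a basis.
\<close>

definition perp_basis :: "nat \<Rightarrow> (nat \<Rightarrow> real) \<Rightarrow> (nat \<Rightarrow> nat \<Rightarrow> real) \<Rightarrow> bool" where
  "perp_basis n u b \<longleftrightarrow>
     (\<forall>i<n - 1. b i \<in> Rn n \<and> dot n (b i) u = 0) \<and>
     (\<forall>i<n - 1. \<forall>j<n - 1. dot n (b i) (b j) = (if i = j then 1 else 0))"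

definition section_volume :: "nat \<Rightarrow> (nat \<Rightarrow> real) set \<Rightarrow> (nat \<Rightarrow> real) \<Rightarrow> real" where
  "section_volume n K u =
     (let b = (SOME b. perp_basis n u b);
          M = Pi\<^sub>M {..<n - 1} (\<lambda>_. lborel)
      in measure M {y \<in> space M. (\<lambda>j. \<Sum>i<n - 1. y i * b i j) \<in> K})"

definition intersection_body :: "nat \<Rightarrow> (nat \<Rightarrow> real) set \<Rightarrow> (nat \<Rightarrow> real) set" where
  "intersection_body n K =
     {vscale r u | r u. u \<in> unit_sphere n \<and> 0 \<le> r \<and> r \<le> section_volume n K u}"

definition banach_mazur :: "nat \<Rightarrow> (nat \<Rightarrow> real) set \<Rightarrow> (nat \<Rightarrow> real) set \<Rightarrow> real" where
  "banach_mazur n K L =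
     Inf {b / a | a b. 0 < a \<and> 0 < b \<and>
            (\<exists>T\<in>GL n. vscale a ` K \<subseteq> T ` L \<and> T ` L \<subseteq> vscale b ` K)}"

lemma perp_basis_exists:
  assumes u: "u \<in> unit_sphere n"
  shows "\<exists>b. perp_basis n u b"
proof -
  have n: "n > 0"
    using u by (cases n) (auto simp: unit_sphere_def)
  define m where "m = n - 1"
  have m: "m < n" using n by (simp add: m_def)
  have uu: "dot n u u = 1"
    using u by (simp add: unit_sphere_def dot_def L2_set_def power2_eq_square)
  have u0: "u j = 0" if "j \<ge> n" for j
    using u that by (simp add: unit_sphere_def topspace_Euclidean_space)
  define e :: "nat \<Rightarrow> nat \<Rightarrow> real" where "e = (\<lambda>i j. if j = i then 1 else 0)"
  define w where "w = (\<lambda>j. u j - e m j)"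
  define k where "k = 1 - u m"
  define b where "b = (\<lambda>i j. e i j - (u i / k) * w j)"
  have ex: "(\<Sum>j<n. e i j * x j) = x i" "(\<Sum>j<n. x j * e i j) = x i" if "i < n" for i x
    using that by (simp_all add: e_def if_distrib if_distribR cong: if_cong)
  show ?thesis
  proof (cases "k = 0")
    case True
    have "(\<Sum>j<n. (u j)\<^sup>2) = (u m)\<^sup>2 + (\<Sum>j\<in>{..<n} - {m}. (u j)\<^sup>2)"
      by (rule sum.remove) (use m in auto)
    moreover have "(\<Sum>j<n. (u j)\<^sup>2) = 1"
      using uu by (simp add: dot_def power2_eq_square)
    ultimately have "(\<Sum>j\<in>{..<n} - {m}. (u j)\<^sup>2) = 0"
      using True by (simp add: k_def)
    then have "\<forall>j\<in>{..<n} - {m}. (u j)\<^sup>2 = 0"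
      by (subst (asm) sum_nonneg_eq_0_iff) auto
    then have z: "u j = 0" if "j < m" for j
      using that m by auto
    have "perp_basis n u e"
      unfolding perp_basis_def m_def[symmetric]
      using m z ex by (auto simp: topspace_Euclidean_space dot_def) (auto simp: e_def)
    then show ?thesis by blast
  next
    case False
    have ww: "(\<Sum>j<n. w j * w j) = 2 * k"
    proof -
      have "(\<Sum>j<n. w j * w j) = (\<Sum>j<n. u j * u j) - (\<Sum>j<n. u j * e m j)
          - (\<Sum>j<n. e m j * u j) + (\<Sum>j<n. e m j * e m j)"
        by (simp add: w_def algebra_simps sum.distrib sum_subtractf sum_distrib_left)
      also have "\<dots> = 2 * k"
        using uu m ex by (simp add: k_def dot_def) (simp add: e_def)
      finally show ?thesis .
    qed
    have ew: "(\<Sum>j<n. e i j * w j) = u i" if "i < m" for i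
      using that m ex(1)[of i w] by (simp add: w_def e_def)
    have wu: "(\<Sum>j<n. w j * u j) = k"
    proof -
      have "(\<Sum>j<n. w j * u j) = (\<Sum>j<n. u j * u j) - (\<Sum>j<n. e m j * u j)"
        by (simp add: w_def algebra_simps sum_subtractf)
      then show ?thesis using uu m ex by (simp add: k_def dot_def)
    qed
    have "dot n (b i) u = 0" if "i < m" for i
    proof -
      have "dot n (b i) u = (\<Sum>j<n. e i j * u j) - (u i / k) * (\<Sum>j<n. w j * u j)"
        by (simp add: dot_def b_def algebra_simps sum_subtractf sum_distrib_left)
      then show ?thesis using that m ex wu False by simp
    qed
    moreover have "dot n (b i) (b j) = (if i = j then 1 else 0)" if "i < m" "j < m" for i j
    proof -
      have "dot n (b i) (b j) = (\<Sum>l<n. e i l * e j l) - (u j / k) * (\<Sum>l<n. e i l * w l)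
          - (u i / k) * (\<Sum>l<n. e j l * w l) + (u i / k) * (u j / k) * (\<Sum>l<n. w l * w l)"
        by (simp add: dot_def b_def algebra_simps sum_subtractf sum.distrib sum_distrib_left
            flip: sum_divide_distrib)
      also have "\<dots> = e j i"
        using that m ex(1)[of i "e j"] ew ww False by (simp add: field_simps)
      finally show ?thesis by (simp add: e_def)
    qed
    moreover have "b i \<in> Rn n" if "i < m" for i
      using that m u0 by (auto simp: topspace_Euclidean_space b_def e_def w_def)
    ultimately have "perp_basis n u b"
      unfolding perp_basis_def m_def[symmetric] by blast
    then show ?thesis by blast
  qed
qed

lemma radial_intersection_body:
  assumes u: "u \<in> unit_sphere n"
  shows "radial (intersection_body n K) u = section_volume n K u"
proof -
  have nn: "0 \<le> section_volume n K u"
    by (simp add: section_volume_def Let_def)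
  have norm: "L2_set (vscale r x) {..<n} = r" if "x \<in> unit_sphere n" "0 \<le> r" for r x
    using that L2_set_right_distrib[of r x "{..<n}"] by (simp add: vscale_def unit_sphere_def)
  have "l \<le> section_volume n K u"
    if l: "0 \<le> l" and *: "vscale l u = vscale r v" "v \<in> unit_sphere n" "0 \<le> r" "r \<le> section_volume n K v"
    for l r v
  proof -
    have "l = r" using norm[OF u l] norm[of v r] * by simp
    then show ?thesis
    proof (cases "l = 0")
      case False
      then have "u = v" using *(1) \<open>l = r\<close> by (auto simp: vscale_def fun_eq_iff)
      then show ?thesis using * \<open>l = r\<close> by simp
    qed (use nn in simp)
  qed
  then have "{l. 0 \<le> l \<and> vscale l u \<in> intersection_body n K} = {0..section_volume n K u}"
    using u unfolding intersection_body_def by (auto, blast)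
  then show ?thesis using nn by (simp add: radial_def)
qed

end

theory Submission
  imports Defs
begin

text \<open>
  Write a point of \<open>\<real>\<^sup>n\<close> as \<open>(s, z)\<close> with \<open>s \<in> \<real>\<^sup>2\<close> and \<open>z \<in> \<real>\<^sup>n\<^sup>-\<^sup>2\<close>, and let \<open>e\<^sub>1, e\<^sub>2\<close> be the
  standard basis of \<open>\<real>\<^sup>2\<close>. The body \<open>K\<close> is the \<open>p\<close>-convex hull of the four discs \<open>(\<plusminus>e\<^sub>i, z)\<close>,
  \<open>\<bar>z\<bar> \<le> 1\<close>; it lies between two balls whose radii depend on \<open>p\<close> only. The sections of \<open>K\<close>
  orthogonal to \<open>e\<^sub>1\<close> and to \<open>e\<^sub>2\<close> contain the cone \<open>\<bar>z\<bar> \<le> \<bar>s\<bar> \<le> 1\<close>, whereas in the section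
  orthogonal to \<open>e\<^sub>1 + e\<^sub>2\<close> one has \<open>\<bar>z\<bar> \<le> 2\<^bsup>1 - 1/p\<^esup>\<close>. Up to subexponential factors the radial
  function of \<open>IK\<close> is thus larger by \<open>2\<^bsup>(1/p - 1)n\<^esup>\<close> in the directions \<open>e\<^sub>1, e\<^sub>2\<close> than in the
  direction \<open>e\<^sub>1 + e\<^sub>2\<close>, which convexity forbids for an ellipsoid close to \<open>IK\<close>.

  The sections are compared with Euclidean balls, which need no rotation: slabs of small
  thickness orthogonal to a direction are translated along this direction.
\<close>

section \<open>Lebesgue measure of balls and cylinders\<close>

abbreviation leb :: "nat \<Rightarrow> (nat \<Rightarrow> real) measure" where
  "leb m \<equiv> Pi\<^sub>M {..<m} (\<lambda>_. lborel)"

text \<open>A product measure is determined by its values on boxes, and on a box the claim splits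
  into one-dimensional affine substitutions. Below, \<open>v = 0\<close> gives the scaling of balls
  and \<open>r = 1\<close> gives translation invariance.\<close>

lemma leb_affine:
  assumes r: "0 < r" and S: "S \<in> sets (leb m)"
  shows "emeasure (leb m) S =
    ennreal (r ^ m) * emeasure (leb m) {y \<in> space (leb m). (\<lambda>i\<in>{..<m}. v i + r * y i) \<in> S}"
proof -
  interpret product_sigma_finite "\<lambda>_::nat. lborel :: real measure"
    by standard
  let ?f = "\<lambda>y. \<lambda>i\<in>{..<m}. v i + r * y i"
  have f[measurable]: "?f \<in> leb m \<rightarrow>\<^sub>M leb m"
    by measurable
  have "density (distr (leb m) (leb m) ?f) (\<lambda>_. ennreal (r ^ m)) = leb m"
  proof (rule PiM_eqI)
    fix A :: "nat \<Rightarrow> real set"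
    assume A: "\<And>i. i \<in> {..<m} \<Longrightarrow> A i \<in> sets lborel"
    let ?B = "\<lambda>i. {t. v i + r * t \<in> A i}"
    have B: "?B i \<in> sets lborel" if "i < m" for i
    proof -
      have [measurable]: "A i \<in> sets borel" using A that by simp
      show ?thesis by simp
    qed
    have AB: "emeasure lborel (A i) = ennreal r * emeasure lborel (?B i)" if "i < m" for i
    proof -
      have [measurable]: "A i \<in> sets borel" using A that by simp
      have "emeasure lborel (A i) =
          emeasure (density (distr lborel borel (\<lambda>x. v i + r * x)) (\<lambda>_. ennreal \<bar>r\<bar>)) (A i)"
        using lborel_real_affine[of r "v i"] r by simp
      also have "\<dots> = ennreal r * emeasure lborel (?B i)"
        using r by (simp add: emeasure_density nn_integral_cmult_indicator emeasure_distr vimage_def)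
      finally show ?thesis .
    qed
    have PA: "Pi\<^sub>E {..<m} A \<in> sets (leb m)"
      using A by (intro sets_PiM_I_finite) auto
    have pre: "?f -` Pi\<^sub>E {..<m} A \<inter> space (leb m) = Pi\<^sub>E {..<m} ?B"
      by (rule set_eqI) (simp add: space_PiM PiE_iff conj_commute)
    have "emeasure (density (distr (leb m) (leb m) ?f) (\<lambda>_. ennreal (r ^ m))) (Pi\<^sub>E {..<m} A)
        = ennreal (r ^ m) * emeasure (leb m) (Pi\<^sub>E {..<m} ?B)"
      using PA by (simp add: emeasure_density nn_integral_cmult_indicator emeasure_distr pre)
    also have "\<dots> = (\<Prod>i<m. ennreal r) * (\<Prod>i<m. emeasure lborel (?B i))"
      using r B by (subst emeasure_PiM) (auto simp: ennreal_power)
    also have "\<dots> = (\<Prod>i<m. emeasure lborel (A i))"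
      by (simp add: prod.distrib[symmetric] AB del: prod_constant)
    finally show "emeasure (density (distr (leb m) (leb m) ?f) (\<lambda>_. ennreal (r ^ m))) (Pi\<^sub>E {..<m} A)
        = (\<Prod>i\<in>{..<m}. emeasure lborel (A i))" .
  qed simp_all
  then have "emeasure (leb m) S = emeasure (density (distr (leb m) (leb m) ?f) (\<lambda>_. ennreal (r ^ m))) S"
    by simp
  also have "\<dots> = ennreal (r ^ m) * emeasure (leb m) (?f -` S \<inter> space (leb m))"
    using S by (simp add: emeasure_density nn_integral_cmult_indicator emeasure_distr)
  also have "?f -` S \<inter> space (leb m) = {y \<in> space (leb m). ?f y \<in> S}"
    by auto
  finally show ?thesis .
qed

text \<open>Points of \<open>space (leb m)\<close> are extensional on \<open>{..<m}\<close>, whereas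
  those of \<open>unit_ball\<close> vanish at large indices; sections are measured in coordinates of
  the first kind.\<close>

definition lball :: "nat \<Rightarrow> real \<Rightarrow> (nat \<Rightarrow> real) set" where
  "lball m r = {y \<in> space (leb m). (\<Sum>i<m. (y i)\<^sup>2) \<le> r\<^sup>2}"

lemma sets_lball [measurable]: "lball m r \<in> sets (leb m)"
  unfolding lball_def by measurable

lemma emeasure_lball_finite: "emeasure (leb m) (lball m r) < \<infinity>"
proof -
  interpret product_sigma_finite "\<lambda>_::nat. lborel :: real measure"
    by standard
  have "lball m r \<subseteq> Pi\<^sub>E {..<m} (\<lambda>_. {- \<bar>r\<bar>..\<bar>r\<bar>})"
  proof
    fix y assume y: "y \<in> lball m r"
    have "y i \<in> {- \<bar>r\<bar>..\<bar>r\<bar>}" if "i < m" for i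
    proof -
      have "(y i)\<^sup>2 \<le> (\<Sum>i<m. (y i)\<^sup>2)"
        using that by (intro member_le_sum) auto
      also have "\<dots> \<le> r\<^sup>2" using y by (simp add: lball_def)
      finally have "\<bar>y i\<bar> \<le> \<bar>r\<bar>" by (simp add: abs_le_square_iff)
      then show ?thesis by (auto simp only: atLeastAtMost_iff abs_le_iff minus_le_iff)
    qed
    then show "y \<in> Pi\<^sub>E {..<m} (\<lambda>_. {- \<bar>r\<bar>..\<bar>r\<bar>})"
      using y by (auto simp: lball_def space_PiM PiE_iff)
  qed
  then have "emeasure (leb m) (lball m r) \<le> emeasure (leb m) (Pi\<^sub>E {..<m} (\<lambda>_. {- \<bar>r\<bar>..\<bar>r\<bar>}))"
    by (intro emeasure_mono) (auto intro!: sets_PiM_I_finite)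
  also have "\<dots> = (\<Prod>i<m. emeasure lborel {- \<bar>r\<bar>..\<bar>r\<bar>})"
    by (rule emeasure_PiM) auto
  also have "\<dots> < \<infinity>"
    by (simp add: ennreal_power)
  finally show ?thesis .
qed

lemma lball_fmeasurable: "lball m r \<in> fmeasurable (leb m)"
  using sets_lball emeasure_lball_finite by (simp add: fmeasurable_def)

lemma measure_lball:
  assumes "0 < r"
  shows "measure (leb m) (lball m r) = r ^ m * measure (leb m) (lball m 1)"
proof -
  have "emeasure (leb m) (lball m r) = ennreal (r ^ m) * emeasure (leb m)
      {y \<in> space (leb m). (\<lambda>i\<in>{..<m}. (\<lambda>_. 0) i + r * y i) \<in> lball m r}"
    by (rule leb_affine) (use assms in auto)
  also have "{y \<in> space (leb m). (\<lambda>i\<in>{..<m}. (\<lambda>_. 0) i + r * y i) \<in> lball m r} = lball m 1"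
    using assms by (auto simp: lball_def space_PiM power_mult_distrib simp flip: sum_distrib_left)
  finally show ?thesis
    using assms by (simp add: measure_def enn2real_mult)
qed

lemma measure_lball_pos: "0 < measure (leb m) (lball m 1)"
proof -
  interpret product_sigma_finite "\<lambda>_::nat. lborel :: real measure"
    by standard
  \<comment> \<open>On this cube \<open>(y i)\<^sup>2 \<le> y i\<close>, so the squares add up to at
    most \<open>m / (1 + m)\<close>.\<close>
  let ?C = "Pi\<^sub>E {..<m} (\<lambda>_. {0..1 / (1 + real m)})"
  have sub: "?C \<subseteq> lball m 1"
  proof
    fix y assume y: "y \<in> ?C"
    have "(y i)\<^sup>2 \<le> 1 / (1 + real m)" if "i < m" for i
    proof -
      have yi: "0 \<le> y i" "y i \<le> 1 / (1 + real m)" using y that by (auto simp: PiE_iff)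
      moreover have "1 / (1 + real m) \<le> 1" by simp
      ultimately have "y i \<le> 1" by linarith
      then have "(y i)\<^sup>2 \<le> y i"
        using yi by (simp add: power2_eq_square mult_left_le)
      with yi show ?thesis by simp
    qed
    then have "(\<Sum>i<m. (y i)\<^sup>2) \<le> (\<Sum>i<m. 1 / (1 + real m))"
      by (intro sum_mono) auto
    also have "\<dots> \<le> 1" by simp
    finally show "y \<in> lball m 1" using y by (auto simp: lball_def space_PiM)
  qed
  have "0 < emeasure (leb m) ?C"
    by (subst emeasure_PiM) (auto simp: ennreal_power)
  also have "\<dots> \<le> emeasure (leb m) (lball m 1)"
    by (intro emeasure_mono sub) simp
  finally show ?thesis
    using emeasure_lball_finite[of m 1] by (simp add: measure_def enn2real_positive_iff)
qed

text \<open>\<open>A\<close> is covered by \<open>K + 1\<close> translates of \<open>S\<close>, all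
  of the same measure. This is the device that stands in for rotation invariance.\<close>

lemma measure_le_cover:
  assumes S: "S \<in> sets (leb m)" and fin: "emeasure (leb m) S < \<infinity>"
    and cover: "\<And>y. y \<in> A \<Longrightarrow> y \<in> space (leb m) \<and>
      (\<exists>k\<le>K::nat. (\<lambda>i\<in>{..<m}. v k i + y i) \<in> S)"
  shows "measure (leb m) A \<le> (real K + 1) * measure (leb m) S"
proof (cases "A \<in> sets (leb m)")
  case True
  let ?T = "\<lambda>k. {y \<in> space (leb m). (\<lambda>i\<in>{..<m}. v k i + y i) \<in> S}"
  have T[measurable]: "?T k \<in> sets (leb m)" for k
    using S by measurable
  have eT: "emeasure (leb m) (?T k) = emeasure (leb m) S" for k
    using leb_affine[of 1 S m "v k"] S by simp
  have "emeasure (leb m) A \<le> emeasure (leb m) (\<Union>k\<le>K. ?T k)"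
    using cover by (intro emeasure_mono) auto
  also have "\<dots> \<le> (\<Sum>k\<le>K. emeasure (leb m) (?T k))"
    by (rule emeasure_subadditive_finite) auto
  also have "\<dots> = ennreal ((real K + 1) * measure (leb m) S)"
    using fin eT by (simp add: emeasure_eq_ennreal_measure ennreal_mult ennreal_of_nat_eq_real_of_nat less_top flip: ennreal_plus add.commute)
  finally show ?thesis
    by (simp add: measure_def enn2real_leI)
next
  case False
  \<comment> \<open>A non-measurable set has \<open>measure\<close> 0 by convention.\<close>
  then show ?thesis by (simp add: measure_notin_sets)
qed

section \<open>Orthonormal coordinates on a hyperplane\<close>

definition frame_map :: "nat \<Rightarrow> (nat \<Rightarrow> nat \<Rightarrow> real) \<Rightarrow> (nat \<Rightarrow> real) \<Rightarrow> nat \<Rightarrow> real" where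
  "frame_map n b y = (\<lambda>j. \<Sum>i<n - 1. y i * b i j)"

text \<open>Trades the choice operator for some frame \<open>b\<close>, of which only orthonormality
  is used afterwards.\<close>

lemma section_volume_frame:
  assumes "u \<in> unit_sphere n"
  obtains b where "perp_basis n u b"
    "section_volume n K u =
      measure (leb (n - 1)) {y \<in> space (leb (n - 1)). frame_map n b y \<in> K}"
  using someI_ex[OF perp_basis_exists[OF assms]]
  by (auto simp: section_volume_def Let_def frame_map_def)

lemma frame_map_in_Rn: "perp_basis n u b \<Longrightarrow> frame_map n b y \<in> Rn n"
  by (auto simp: perp_basis_def frame_map_def topspace_Euclidean_space intro!: sum.neutral)

lemma dot_frame_map:
  assumes "perp_basis n u b"
  shows "dot n (frame_map n b y) u = 0"
proof -
  have "dot n (frame_map n b y) u = (\<Sum>i<n - 1. y i * dot n (b i) u)"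
    unfolding dot_def frame_map_def sum_distrib_left sum_distrib_right
    by (subst sum.swap) (simp add: mult.assoc)
  also have "\<dots> = 0"
    using assms by (intro sum.neutral) (auto simp: perp_basis_def)
  finally show ?thesis .
qed

lemma L2_frame_map:
  assumes "perp_basis n u b"
  shows "(L2_set (frame_map n b y) {..<n})\<^sup>2 = (\<Sum>i<n - 1. (y i)\<^sup>2)"
proof -
  have "(L2_set (frame_map n b y) {..<n})\<^sup>2 =
      (\<Sum>j<n. \<Sum>i<n - 1. \<Sum>k<n - 1. y i * y k * (b i j * b k j))"
    unfolding L2_set_def
    by (subst real_sqrt_pow2, simp add: sum_nonneg)
       (simp add: frame_map_def power2_eq_square sum_product mult_ac)
  also have "\<dots> = (\<Sum>i<n - 1. \<Sum>k<n - 1. \<Sum>j<n. y i * y k * (b i j * b k j))"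
    by (subst sum.swap) (intro sum.cong refl sum.swap)
  also have "\<dots> = (\<Sum>i<n - 1. \<Sum>k<n - 1. y i * y k * dot n (b i) (b k))"
    by (simp add: dot_def sum_distrib_left)
  also have "\<dots> = (\<Sum>i<n - 1. \<Sum>k<n - 1. if i = k then (y i)\<^sup>2 else 0)"
    using assms by (intro sum.cong refl) (auto simp: perp_basis_def power2_eq_square)
  also have "\<dots> = (\<Sum>i<n - 1. (y i)\<^sup>2)"
    by simp
  finally show ?thesis .
qed

text \<open>
  By Bessel's inequality each column of an orthonormal system of \<open>n\<close> vectors has norm at most \<open>1\<close>;
  since the squared column norms sum up to \<open>n\<close>, all of them equal \<open>1\<close>.
\<close>

lemma orthonormal_column:
  fixes B :: "nat \<Rightarrow> nat \<Rightarrow> real"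
  assumes B: "\<And>i k. i < n \<Longrightarrow> k < n \<Longrightarrow> (\<Sum>j<n. B i j * B k j) = (if i = k then 1 else 0)"
    and j: "j < n"
  shows "(\<Sum>i<n. (B i j)\<^sup>2) = 1"
proof -
  have bessel: "0 \<le> 1 - (\<Sum>i<n. (B i j)\<^sup>2)" if j: "j < n" for j
  proof -
    let ?e = "\<lambda>k. if k = j then 1 else 0 :: real"
    \<comment> \<open>\<open>?w\<close> is the orthogonal projection of the basis vector
      \<open>?e\<close> onto the span of the rows, so the squared distance of the two is
      \<open>1\<close> minus the squared norm of \<open>?w\<close>.\<close>
    let ?w = "\<lambda>k. \<Sum>i<n. B i j * B i k"
    have "(\<Sum>k<n. (?w k)\<^sup>2) = (\<Sum>k<n. \<Sum>i<n. \<Sum>l<n. B i j * B l j * (B i k * B l k))"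
      by (simp add: power2_eq_square sum_product mult_ac)
    also have "\<dots> = (\<Sum>i<n. \<Sum>l<n. \<Sum>k<n. B i j * B l j * (B i k * B l k))"
      by (subst sum.swap) (intro sum.cong refl sum.swap)
    also have "\<dots> = (\<Sum>i<n. \<Sum>l<n. if i = l then (B i j)\<^sup>2 else 0)"
      by (intro sum.cong refl) (auto simp: B power2_eq_square simp flip: sum_distrib_left)
    finally have ww: "(\<Sum>k<n. (?w k)\<^sup>2) = (\<Sum>i<n. (B i j)\<^sup>2)"
      by simp
    have "0 \<le> (\<Sum>k<n. (?e k - ?w k)\<^sup>2)"
      by (intro sum_nonneg) auto
    also have "\<dots> = (\<Sum>k<n. (if k = j then 1 - 2 * ?w j else 0) + (?w k)\<^sup>2)"
      by (intro sum.cong refl) (auto simp: power2_diff)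
    also have "\<dots> = 1 - 2 * ?w j + (\<Sum>k<n. (?w k)\<^sup>2)"
      using j by (simp add: sum.distrib)
    also have "\<dots> = 1 - (\<Sum>i<n. (B i j)\<^sup>2)"
      unfolding ww by (simp add: power2_eq_square)
    finally show ?thesis .
  qed
  have "(\<Sum>j<n. \<Sum>i<n. (B i j)\<^sup>2) = (\<Sum>i<n. \<Sum>j<n. B i j * B i j)"
    by (subst sum.swap) (simp add: power2_eq_square)
  also have "\<dots> = real n"
    by (simp add: B)
  finally have "(\<Sum>j<n. 1 - (\<Sum>i<n. (B i j)\<^sup>2)) = 0"
    by (simp add: sum_subtractf)
  then have "\<forall>j\<in>{..<n}. 1 - (\<Sum>i<n. (B i j)\<^sup>2) = 0"
    using bessel by (subst (asm) sum_nonneg_eq_0_iff) auto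
  with j show ?thesis by simp
qed

text \<open>Adjoining \<open>u\<close> to the frame gives \<open>n\<close> orthonormal vectors,
  whose \<open>j\<close>-th column has norm 1. The sum is thus the squared norm of the functional
  that reads off coordinate \<open>j\<close> on the hyperplane.\<close>

lemma perp_basis_column:
  assumes u: "u \<in> unit_sphere n" and b: "perp_basis n u b" and j: "j < n"
  shows "(\<Sum>i<n - 1. (b i j)\<^sup>2) = 1 - (u j)\<^sup>2"
proof -
  define B where "B i = (if i < n - 1 then b i else u)" for i
  have uu: "(\<Sum>j<n. u j * u j) = 1"
    using u by (simp add: unit_sphere_def L2_set_def power2_eq_square)
  have "(\<Sum>i<n. (B i j)\<^sup>2) = 1"
  proof (rule orthonormal_column[OF _ j])
    fix i k assume "i < n" "k < n"
    then have "i = n - 1 \<or> i < n - 1" "k = n - 1 \<or> k < n - 1" by auto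
    then show "(\<Sum>j<n. B i j * B k j) = (if i = k then 1 else 0)"
      using b uu by (auto simp: B_def perp_basis_def dot_def mult.commute)
  qed
  also have "(\<Sum>i<n. (B i j)\<^sup>2) = (\<Sum>i<n - 1. (B i j)\<^sup>2) + (B (n - 1) j)\<^sup>2"
    using j by (cases n) auto
  finally show ?thesis by (simp add: B_def)
qed

section \<open>Comparing cylinders with balls by sliding slabs\<close>

lemma shift_along:
  fixes y g :: "nat \<Rightarrow> real"
  assumes "(\<Sum>i<m. (g i)\<^sup>2) = 1"
  shows "(\<Sum>i<m. (s * g i + y i) * g i) = s + (\<Sum>i<m. y i * g i)"
    and "(\<Sum>i<m. (s * g i + y i)\<^sup>2) = s\<^sup>2 + 2 * s * (\<Sum>i<m. y i * g i) + (\<Sum>i<m. (y i)\<^sup>2)"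
proof -
  have "(\<Sum>i<m. (s * g i + y i) * g i) = (\<Sum>i<m. s * (g i)\<^sup>2 + y i * g i)"
    by (intro sum.cong refl) (simp add: power2_eq_square algebra_simps)
  then show "(\<Sum>i<m. (s * g i + y i) * g i) = s + (\<Sum>i<m. y i * g i)"
    by (simp add: sum.distrib assms flip: sum_distrib_left)
  have "(\<Sum>i<m. (s * g i + y i)\<^sup>2) = (\<Sum>i<m. s\<^sup>2 * (g i)\<^sup>2 + 2 * s * (y i * g i) + (y i)\<^sup>2)"
    by (intro sum.cong refl) (simp add: power2_eq_square algebra_simps)
  then show "(\<Sum>i<m. (s * g i + y i)\<^sup>2) =
      s\<^sup>2 + 2 * s * (\<Sum>i<m. y i * g i) + (\<Sum>i<m. (y i)\<^sup>2)"
    by (simp add: sum.distrib assms flip: sum_distrib_left)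
qed

text \<open>Slicing a ball of radius \<open>1 - 1/N\<close> into slabs of thickness \<open>1/N\<close> orthogonal to \<open>g\<close>.\<close>

lemma measure_slab_ge:
  fixes N :: nat
  assumes g: "(\<Sum>i<m. (g i)\<^sup>2) = 1" and N: "2 \<le> N"
  defines "C \<equiv> {y \<in> space (leb m). 1 - 1 / N \<le> (\<Sum>i<m. y i * g i) \<and> (\<Sum>i<m. y i * g i) \<le> 1 \<and>
      (\<Sum>i<m. (y i)\<^sup>2) - (\<Sum>i<m. y i * g i)\<^sup>2 \<le> (1 - 1 / N)\<^sup>2}"
  shows "(1 - 1 / N) ^ m * measure (leb m) (lball m 1) \<le> (2 * N + 1) * measure (leb m) C"
    and "C \<in> sets (leb m)"
proof -
  show C: "C \<in> sets (leb m)"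
    unfolding C_def by measurable
  define r where "r = 1 - 1 / real N"
  have r: "0 < r" "r \<le> 1" using N by (auto simp: r_def field_simps)
  have "C \<subseteq> lball m 2"
  proof
    fix y assume y: "y \<in> C"
    then have "(\<Sum>i<m. y i * g i)\<^sup>2 \<le> 1"
      using r by (auto simp: C_def r_def[symmetric] power_le_one)
    moreover have "r\<^sup>2 \<le> 1" using r by (simp add: power_le_one)
    ultimately show "y \<in> lball m 2"
      using y by (auto simp: C_def lball_def r_def)
  qed
  then have "emeasure (leb m) C \<le> emeasure (leb m) (lball m 2)"
    by (intro emeasure_mono) auto
  with emeasure_lball_finite[of m 2] have fin: "emeasure (leb m) C < \<infinity>"
    by (rule le_less_trans[rotated])
  have "measure (leb m) (lball m r) \<le> (real (2 * N) + 1) * measure (leb m) C"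
  proof (rule measure_le_cover[OF C fin, where v = "\<lambda>k i. real k / real N * g i"])
    fix y assume y: "y \<in> lball m r"
    define t where "t = (\<Sum>i<m. y i * g i)"
    have Nr: "real N * r = real N - 1" using N by (simp add: r_def field_simps)
    \<comment> \<open>The least number of steps of length \<open>1 / N\<close> that lifts the
      component \<open>t\<close> to at least \<open>r = 1 - 1 / N\<close>; it then overshoots to at
      most 1. Since \<open>t\<close> is at least \<open>- r\<close>, fewer than \<open>2 * N\<close>
      steps suffice.\<close>
    define k where "k = nat \<lceil>real N * (r - t)\<rceil>"
    have "t\<^sup>2 \<le> (\<Sum>i<m. (y i)\<^sup>2) * (\<Sum>i<m. (g i)\<^sup>2)"
      unfolding t_def by (rule Cauchy_Schwarz_ineq_sum)
    also have "\<dots> \<le> r\<^sup>2" using y g by (simp add: lball_def)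
    finally have t: "\<bar>t\<bar> \<le> r" using r by (simp flip: abs_le_square_iff)
    have nn: "0 \<le> real N * (r - t)" using t by simp
    then have k: "real k = of_int \<lceil>real N * (r - t)\<rceil>"
      by (simp add: k_def)
    have k1: "real N * (r - t) \<le> real k" "real k \<le> real N * (r - t) + 1"
      unfolding k by linarith+
    have "real N * (r - t) \<le> real N * (2 * r)"
      using t by (intro mult_left_mono) auto
    also have "\<dots> = 2 * real N - 2" using N by (simp add: r_def field_simps)
    finally have "real k \<le> real (2 * N)" using k1 by simp
    then have kN: "k \<le> 2 * N" by simp
    have N0: "0 < real N" using N by simp
    have "real N * (r - t) \<le> real k" "real k \<le> real N * (1 - t)"
      using k1 Nr by (simp_all add: right_diff_distrib)
    then have k2: "r - t \<le> real k / N" "real k / N \<le> 1 - t"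
      by (simp_all only: pos_le_divide_eq[OF N0] pos_divide_le_eq[OF N0] mult.commute)
    define s where "s = real k / N"
    have sh: "(\<Sum>i<m. (s * g i + y i) * g i) = s + t"
      "(\<Sum>i<m. (s * g i + y i)\<^sup>2) - (s + t)\<^sup>2 = (\<Sum>i<m. (y i)\<^sup>2) - t\<^sup>2"
      using shift_along[OF g, of s y] by (simp_all add: t_def power2_sum)
    have "(\<Sum>i<m. (y i)\<^sup>2) - t\<^sup>2 \<le> r\<^sup>2"
      using y zero_le_power2[of t] unfolding lball_def mem_Collect_eq by linarith
    then have "(\<lambda>i\<in>{..<m}. s * g i + y i) \<in> C"
      using k2 sh by (simp add: C_def space_PiM r_def[symmetric] s_def[symmetric])
    then show "y \<in> space (leb m) \<and> (\<exists>k\<le>2 * N. (\<lambda>i\<in>{..<m}. real k / real N * g i + y i) \<in> C)"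
      using kN y by (auto simp: lball_def s_def)
  qed
  then show "(1 - 1 / N) ^ m * measure (leb m) (lball m 1) \<le> (2 * N + 1) * measure (leb m) C"
    using measure_lball[OF r(1), of m] by (simp add: r_def add.commute)
qed

text \<open>\<open>A\<close> lies in a cylinder of radius \<open>r\<close> and length 4 around the
  axis \<open>g\<close>. A slab of thickness \<open>1 / N\<close> of it, slid to the origin, fits
  into the ball of radius \<open>r + 1 / N\<close>.\<close>

lemma measure_cylinder_le:
  fixes N :: nat
  assumes g: "(\<Sum>i<m. (g i)\<^sup>2) = 1" and N: "1 \<le> N" and r: "0 < r"
    and A: "\<And>y. y \<in> A \<Longrightarrow> y \<in> space (leb m) \<and> \<bar>\<Sum>i<m. y i * g i\<bar> \<le> 2 \<and>
      (\<Sum>i<m. (y i)\<^sup>2) - (\<Sum>i<m. y i * g i)\<^sup>2 \<le> r\<^sup>2"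
  shows "measure (leb m) A \<le> (4 * N + 1) * ((r + 1 / N) ^ m * measure (leb m) (lball m 1))"
proof -
  have "measure (leb m) A \<le> (real (4 * N) + 1) * measure (leb m) (lball m (r + 1 / N))"
  proof (rule measure_le_cover[OF sets_lball emeasure_lball_finite,
        where v = "\<lambda>k i. (real k / real N - 2) * g i"])
    fix y assume y: "y \<in> A"
    define t where "t = (\<Sum>i<m. y i * g i)"
    \<comment> \<open>Rounding down places the shifted component \<open>s + t\<close> in
      \<open>[- 1 / N, 0]\<close>; the offset \<open>- 2\<close> in \<open>s\<close> matches the end
      of the cylinder, so \<open>k\<close> runs from 0 to \<open>4 * N\<close>.\<close>
    define k where "k = nat \<lfloor>real N * (2 - t)\<rfloor>"
    define s where "s = real k / N - 2"
    have t: "\<bar>t\<bar> \<le> 2" and yt: "(\<Sum>i<m. (y i)\<^sup>2) - t\<^sup>2 \<le> r\<^sup>2"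
      using A[OF y] by (auto simp: t_def)
    have "0 \<le> real N * (2 - t)" using t by simp
    then have k: "real k = of_int \<lfloor>real N * (2 - t)\<rfloor>"
      by (simp add: k_def)
    have k1: "real k \<le> real N * (2 - t)" "real N * (2 - t) \<le> real k + 1"
      unfolding k by linarith+
    have "real N * (2 - t) \<le> real N * 4"
      using t by (intro mult_left_mono) auto
    then have "real k \<le> real (4 * N)" using k1 by simp
    then have kN: "k \<le> 4 * N" by simp
    have "s + t \<le> 0" "- (1 / N) \<le> s + t"
      using k1 N by (simp_all add: s_def field_simps)
    then have "(s + t)\<^sup>2 \<le> (1 / N)\<^sup>2"
      by (simp flip: abs_le_square_iff)
    then have "s\<^sup>2 + 2 * s * t + (\<Sum>i<m. (y i)\<^sup>2) \<le> r\<^sup>2 + (1 / N)\<^sup>2"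
      using yt by (simp add: power2_sum)
    also have "\<dots> \<le> (r + 1 / N)\<^sup>2"
      using r by (simp add: power2_sum)
    finally have "(\<lambda>i\<in>{..<m}. s * g i + y i) \<in> lball m (r + 1 / N)"
      using shift_along(2)[OF g, of s y] by (simp add: lball_def space_PiM t_def)
    then show "y \<in> space (leb m) \<and>
        (\<exists>k\<le>4 * N. (\<lambda>i\<in>{..<m}. (real k / real N - 2) * g i + y i) \<in> lball m (r + 1 / N))"
      using kN A[OF y] by (auto simp: s_def)
  qed
  also have "measure (leb m) (lball m (r + 1 / N)) = (r + 1 / N) ^ m * measure (leb m) (lball m 1)"
    using r N by (intro measure_lball) (simp add: add_pos_nonneg)
  finally show ?thesis by (simp add: add.commute)
qed

section \<open>Bodies given by a \<open>p\<close>-subadditive gauge\<close>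

lemma Rn_add: "x \<in> Rn n \<Longrightarrow> y \<in> Rn n \<Longrightarrow> vadd x y \<in> Rn n"
  by (auto simp: topspace_Euclidean_space vadd_def)

lemma Rn_scale: "x \<in> Rn n \<Longrightarrow> vscale t x \<in> Rn n"
  by (auto simp: topspace_Euclidean_space vscale_def)

lemma Rn_zero: "(\<lambda>i. 0) \<in> Rn n"
  by (auto simp: topspace_Euclidean_space)

lemma Rn_eq_zero:
  assumes "x \<in> Rn n" "L2_set x {..<n} = 0"
  shows "x = (\<lambda>i. 0)"
proof
  show "x i = 0" for i
    using assms by (cases "i < n") (auto simp: topspace_Euclidean_space L2_set_eq_0_iff)
qed

lemma vscale_vscale: "vscale s (vscale t x) = vscale (s * t) x"
  by (simp add: vscale_def mult.assoc)

lemma vscale_one: "vscale 1 x = x"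
  by (simp add: vscale_def)

lemma L2_set_vscale: "0 \<le> t \<Longrightarrow> L2_set (vscale t x) A = t * L2_set x A"
  by (simp add: vscale_def L2_set_right_distrib)

lemma id_in_GL: "(\<lambda>x. x) \<in> GL n"
  by (auto simp: GL_def bij_betw_def)

lemma closed_Rn: "closed (Rn n)"
proof -
  have "Rn n = (\<Inter>i\<in>{n..}. {x. x i = 0})"
    by (auto simp: topspace_Euclidean_space)
  also have "closed \<dots>"
    by (intro closed_INT ballI closed_Collect_eq continuous_intros continuous_on_product_coordinates)
  finally show ?thesis .
qed

lemma Euclidean_space_eq: "Euclidean_space n = top_of_set {x. \<forall>i\<ge>n. x i = 0}"
  by (simp add: Euclidean_space_def euclidean_product_topology)

lemma banach_mazur_le:
  assumes "0 < a" "0 < b" "T \<in> GL n" "vscale a ` K \<subseteq> T ` L" "T ` L \<subseteq> vscale b ` K"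
  shows "banach_mazur n K L \<le> b / a"
  unfolding banach_mazur_def
  by (rule cInf_lower) (use assms in \<open>auto intro!: bdd_belowI[of _ 0]\<close>)

lemma unit_sphere_normalize:
  assumes "x \<in> Rn n" "L2_set x {..<n} \<noteq> 0"
  obtains u where "u \<in> unit_sphere n" "x = vscale (L2_set x {..<n}) u"
proof
  let ?r = "L2_set x {..<n}"
  have r: "0 < ?r" using assms(2) L2_set_nonneg[of x "{..<n}"] by linarith
  then show "vscale (1 / ?r) x \<in> unit_sphere n"
    using assms by (simp add: unit_sphere_def Rn_scale L2_set_vscale)
  show "x = vscale ?r (vscale (1 / ?r) x)"
    using r by (simp add: vscale_vscale vscale_one)
qed

definition unit_vec :: "nat \<Rightarrow> nat \<Rightarrow> real" where
  "unit_vec i = (\<lambda>j. if j = i then 1 else 0)"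

lemma unit_vec_in_sphere:
  assumes "i < n"
  shows "unit_vec i \<in> unit_sphere n"
proof -
  have "(\<Sum>j<n. (if j = i then 1 else 0 :: real)\<^sup>2) = (\<Sum>j<n. if j = i then 1 else 0)"
    by (intro sum.cong) auto
  then show ?thesis
    using assms by (auto simp: unit_vec_def unit_sphere_def topspace_Euclidean_space L2_set_def)
qed

text \<open>\<open>q\<close> stands for the \<open>p\<close>-th power of a Minkowski functional,
  which turns \<open>p\<close>-convexity into plain subadditivity. The last two conditions place the
  body \<open>q \<le> 1\<close> between the Euclidean balls of radii \<open>1 / \<beta>\<close> and
  \<open>1 / \<alpha>\<close>.\<close>

locale quasi_gauge =
  fixes n :: nat and p \<alpha> \<beta> :: real and q :: "(nat \<Rightarrow> real) \<Rightarrow> real"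
  assumes n_pos: "0 < n" and p_pos: "0 < p" and \<alpha>_pos: "0 < \<alpha>" and \<beta>_pos: "0 < \<beta>"
    and q_add: "x \<in> Rn n \<Longrightarrow> y \<in> Rn n \<Longrightarrow> q (vadd x y) \<le> q x + q y"
    and q_scale: "0 \<le> t \<Longrightarrow> x \<in> Rn n \<Longrightarrow> q (vscale t x) = t powr p * q x"
    and q_ge: "x \<in> Rn n \<Longrightarrow> (\<alpha> * L2_set x {..<n}) powr p \<le> q x"
    and q_le: "x \<in> Rn n \<Longrightarrow> q x \<le> (\<beta> * L2_set x {..<n}) powr p"

definition gauge_body :: "nat \<Rightarrow> ((nat \<Rightarrow> real) \<Rightarrow> real) \<Rightarrow> (nat \<Rightarrow> real) set" where
  "gauge_body n q = {x \<in> Rn n. q x \<le> 1}"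

lemma gauge_nonneg:
  assumes G: "quasi_gauge n p \<alpha> \<beta> q"
  shows "x \<in> Rn n \<Longrightarrow> 0 \<le> q x"
  using quasi_gauge.q_ge[OF G, of x] powr_ge_zero[of "\<alpha> * L2_set x {..<n}" p] by linarith

lemma gauge_pos:
  assumes G: "quasi_gauge n p \<alpha> \<beta> q"
    and "x \<in> Rn n" "L2_set x {..<n} \<noteq> 0"
  shows "0 < q x"
proof -
  have "0 < L2_set x {..<n}" using assms(3) L2_set_nonneg[of x "{..<n}"] by linarith
  then have "0 < (\<alpha> * L2_set x {..<n}) powr p" using quasi_gauge.\<alpha>_pos[OF G] by simp
  then show ?thesis using quasi_gauge.q_ge[OF G assms(2)] by linarith
qed

text \<open>Subadditivity bounds the increment of \<open>q\<close> by its value at the difference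
  vector, hence by a power of the distance. The distance is symmetric, so one bound covers both
  signs of the increment.\<close>

lemma continuous_on_gauge:
  assumes G: "quasi_gauge n p \<alpha> \<beta> q"
  shows "continuous_on (Rn n) q"
  unfolding continuous_on_def
proof
  fix x assume x: "x \<in> Rn n"
  let ?d = "\<lambda>y. (\<beta> * L2_set (\<lambda>i. y i - x i) {..<n}) powr p"
  have diff: "q u \<le> q v + (\<beta> * L2_set (\<lambda>i. u i - v i) {..<n}) powr p"
    if "u \<in> Rn n" "v \<in> Rn n" for u v
  proof -
    let ?w = "\<lambda>i. u i - v i"
    have w: "?w \<in> Rn n" using that by (auto simp: topspace_Euclidean_space)
    have "u = vadd v ?w" by (simp add: vadd_def)
    with quasi_gauge.q_add[OF G that(2) w] quasi_gauge.q_le[OF G w] show ?thesis by simp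
  qed
  have sym: "L2_set (\<lambda>i. x i - y i) {..<n} = L2_set (\<lambda>i. y i - x i) {..<n}" for y
    by (simp add: L2_set_def power2_commute)
  have bound: "norm (q y - q x) \<le> ?d y" if "y \<in> Rn n" for y
    using diff[OF that x] diff[OF x that] by (simp add: sym abs_le_iff)
  have coord: "((\<lambda>y. y i) \<longlongrightarrow> x i) (at x within Rn n)" for i
    using continuous_on_product_coordinates[of i, unfolded continuous_on_def, rule_format, of x]
    by (rule tendsto_within_subset) auto
  have "((\<lambda>y. \<beta> * L2_set (\<lambda>i. y i - x i) {..<n}) \<longlongrightarrow> \<beta> * L2_set (\<lambda>i. x i - x i) {..<n})
      (at x within Rn n)"
    unfolding L2_set_def
    by (intro tendsto_intros coord)
  then have "((\<lambda>y. \<beta> * L2_set (\<lambda>i. y i - x i) {..<n}) \<longlongrightarrow> 0) (at x within Rn n)"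
    by (simp add: L2_set_def)
  then have "(?d \<longlongrightarrow> 0 powr p) (at x within Rn n)"
    by (rule tendsto_powr') (use quasi_gauge.p_pos[OF G] quasi_gauge.\<beta>_pos[OF G] in auto)
  then have "(?d \<longlongrightarrow> 0) (at x within Rn n)"
    by simp
  then have "((\<lambda>y. q y - q x) \<longlongrightarrow> 0) (at x within Rn n)"
    by (rule Lim_null_comparison[rotated]) (auto simp only: eventually_at_filter intro!: always_eventually bound)
  then show "(q \<longlongrightarrow> q x) (at x within Rn n)"
    by (simp add: LIM_zero_iff)
qed

lemma gauge_body_norm_le:
  assumes G: "quasi_gauge n p \<alpha> \<beta> q"
  shows "x \<in> gauge_body n q \<Longrightarrow> L2_set x {..<n} \<le> 1 / \<alpha>"
proof -
  assume x: "x \<in> gauge_body n q"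
  then have "(\<alpha> * L2_set x {..<n}) powr p \<le> 1"
    using quasi_gauge.q_ge[OF G, of x] by (auto simp: gauge_body_def)
  then have "\<alpha> * L2_set x {..<n} \<le> 1"
    using powr_less_mono2[OF quasi_gauge.p_pos[OF G] zero_le_one, of "\<alpha> * L2_set x {..<n}"]
    by (metis not_le powr_one_eq_one)
  then show ?thesis using quasi_gauge.\<alpha>_pos[OF G] by (simp add: field_simps)
qed

lemma gauge_bodyI:
  assumes G: "quasi_gauge n p \<alpha> \<beta> q"
    and "x \<in> Rn n" "L2_set x {..<n} \<le> 1 / \<beta>"
  shows "x \<in> gauge_body n q"
proof -
  have "(\<beta> * L2_set x {..<n}) powr p \<le> 1"
    using assms quasi_gauge.\<beta>_pos[OF G] quasi_gauge.p_pos[OF G] by (intro powr_le1) (auto simp: field_simps)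
  then show ?thesis using assms quasi_gauge.q_le[OF G, of x] by (simp add: gauge_body_def)
qed

lemma zero_in_gauge_body:
  assumes G: "quasi_gauge n p \<alpha> \<beta> q"
  shows "(\<lambda>i. 0) \<in> gauge_body n q"
  using quasi_gauge.\<beta>_pos[OF G] by (intro gauge_bodyI[OF G] Rn_zero) (simp add: L2_set_def)

lemma closed_gauge_body:
  assumes G: "quasi_gauge n p \<alpha> \<beta> q"
  shows "closed (gauge_body n q)"
proof -
  have "gauge_body n q = Rn n \<inter> q -` {..1}" by (auto simp: gauge_body_def)
  then show ?thesis
    using continuous_closed_preimage[OF continuous_on_gauge[OF G] closed_Rn closed_atMost] by simp
qed

lemma body_gauge_body:
  assumes G: "quasi_gauge n p \<alpha> \<beta> q"
  shows "body n (gauge_body n q)"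
  unfolding body_def
proof
  \<comment> \<open>A cube over all indices, compact by Tychonoff; the coordinates from
    \<open>n\<close> on are 0 and fit as well.\<close>
  let ?B = "Pi\<^sub>E UNIV (\<lambda>i::nat. {- (1 / \<alpha>)..1 / \<alpha>})"
  have "compactin (powertop_real UNIV) ?B"
    by (simp add: compactin_PiE)
  then have B: "compact ?B"
    by (simp add: euclidean_product_topology)
  have "gauge_body n q \<subseteq> ?B"
  proof
    fix x assume x: "x \<in> gauge_body n q"
    have "\<bar>x i\<bar> \<le> 1 / \<alpha>" for i
    proof (cases "i < n")
      case True
      then have "\<bar>x i\<bar> \<le> L2_set (\<lambda>i. \<bar>x i\<bar>) {..<n}"
        by (intro member_le_L2_set) auto
      with gauge_body_norm_le[OF G x] show ?thesis by (simp add: L2_set_def)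
    next
      case False
      then have "x i = 0" using x by (auto simp: gauge_body_def topspace_Euclidean_space)
      then show ?thesis using quasi_gauge.\<alpha>_pos[OF G] by simp
    qed
    then have "x i \<in> {- (1 / \<alpha>)..1 / \<alpha>}" for i
      by (auto simp only: atLeastAtMost_iff abs_le_iff minus_le_iff)
    then show "x \<in> ?B" by blast
  qed
  then have "compact (gauge_body n q)"
    using B closed_gauge_body[OF G] compact_Int_closed[of ?B "gauge_body n q"] by (simp add: Int_absorb1)
  then show "compactin (Euclidean_space n) (gauge_body n q)"
    by (auto simp add: Euclidean_space_eq compactin_subtopology gauge_body_def)
  have "openin (Euclidean_space n) {x \<in> Rn n. q x < 1}"
  proof -
    have "{x \<in> Rn n. q x < 1} = Rn n \<inter> q -` {..<1}" by auto
    then show ?thesis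
      using continuous_openin_preimage_gen[OF continuous_on_gauge[OF G] open_lessThan[of 1]]
      by (simp add: Euclidean_space_eq)
  qed
  moreover have "q (\<lambda>i. 0) = 0"
    using quasi_gauge.q_le[OF G Rn_zero] gauge_nonneg[OF G Rn_zero] quasi_gauge.p_pos[OF G] by (simp add: L2_set_def)
  ultimately have "(\<lambda>i. 0) \<in> Euclidean_space n interior_of (gauge_body n q)"
    unfolding interior_of_def mem_Collect_eq
    by (intro exI[of _ "{x \<in> Rn n. q x < 1}"]) (auto simp: gauge_body_def Rn_zero)
  then show "Euclidean_space n interior_of (gauge_body n q) \<noteq> {}" by blast
qed

lemma mem_vscale_gauge_body_iff:
  assumes G: "quasi_gauge n p \<alpha> \<beta> q"
    and x: "x \<in> Rn n" and l: "0 < l"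
  shows "x \<in> vscale l ` gauge_body n q \<longleftrightarrow> q x \<le> l powr p"
proof -
  have "x \<in> vscale l ` gauge_body n q \<longleftrightarrow> vscale (1 / l) x \<in> gauge_body n q"
    using l by (auto simp: vscale_vscale vscale_one intro!: image_eqI[of _ _ "vscale (1 / l) x"])
  also have "\<dots> \<longleftrightarrow> q x \<le> l powr p"
    using x l by (simp add: gauge_body_def Rn_scale quasi_gauge.q_scale[OF G] powr_divide field_simps)
  finally show ?thesis .
qed

lemma powr_inverse_le_iff:
  fixes a l p :: real
  assumes "0 < p" "0 \<le> a" "0 \<le> l"
  shows "a powr (1 / p) \<le> l \<longleftrightarrow> a \<le> l powr p"
proof
  assume "a powr (1 / p) \<le> l"
  then have "(a powr (1 / p)) powr p \<le> l powr p"
    using assms by (intro powr_mono2) simp_all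
  then show "a \<le> l powr p" using assms by (simp add: powr_powr)
next
  assume "a \<le> l powr p"
  then have "a powr (1 / p) \<le> (l powr p) powr (1 / p)"
    using assms by (intro powr_mono2) simp_all
  then show "a powr (1 / p) \<le> l" using assms by (simp add: powr_powr)
qed

lemma gauge_eq_0_iff:
  assumes G: "quasi_gauge n p \<alpha> \<beta> q" and x: "x \<in> Rn n"
  shows "q x = 0 \<longleftrightarrow> x = (\<lambda>i. 0)"
proof
  assume "q x = 0"
  then have "L2_set x {..<n} = 0" using gauge_pos[OF G x] by linarith
  with x show "x = (\<lambda>i. 0)" by (rule Rn_eq_zero)
next
  assume "x = (\<lambda>i. 0)"
  then have "L2_set x {..<n} = 0" by (simp add: L2_set_def)
  then show "q x = 0"
    using quasi_gauge.q_le[OF G x] gauge_nonneg[OF G x] by simp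
qed

text \<open>The Minkowski functional is \<open>q x powr (1 / p)\<close>, so its \<open>p\<close>-th
  power is \<open>q\<close>, which is subadditive.\<close>

lemma p_convex_gauge_body:
  assumes G: "quasi_gauge n p \<alpha> \<beta> q"
  shows "p_convex n p (gauge_body n q)"
proof -
  have mink: "minkowski (gauge_body n q) x = q x powr (1 / p)" if x: "x \<in> Rn n" for x
  proof -
    have "(0 \<le> l \<and> x \<in> vscale l ` gauge_body n q) = (q x powr (1 / p) \<le> l)" for l
    proof -
      consider "l < 0" | "l = 0" | "0 < l" by linarith
      then show ?thesis
      proof cases
        case 1
        then show ?thesis using powr_ge_zero[of "q x" "1 / p"] by linarith
      next
        \<comment> \<open>The dilate by 0 is the origin alone, which is also the only zero of
          \<open>q\<close>.\<close>
        case 2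
        have "vscale 0 ` gauge_body n q = {\<lambda>i. 0}"
          unfolding vscale_def mult_zero_left by (rule image_constant[OF zero_in_gauge_body[OF G]])
        then show ?thesis
          using 2 gauge_eq_0_iff[OF G x] by simp
      next
        case 3
        then show ?thesis
          using mem_vscale_gauge_body_iff[OF G x 3] gauge_nonneg[OF G x]
            powr_inverse_le_iff[OF quasi_gauge.p_pos[OF G], of "q x" l] by simp
      qed
    qed
    then show ?thesis
      unfolding minkowski_def by (intro cInf_eq_minimum) simp_all
  qed
  show ?thesis
    unfolding p_convex_def
    using body_gauge_body[OF G] quasi_gauge.p_pos[OF G]
    by (simp add: mink Rn_add quasi_gauge.q_add[OF G] gauge_nonneg[OF G] powr_powr)
qed

lemma radial_gauge_body:
  assumes G: "quasi_gauge n p \<alpha> \<beta> q"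
    and u: "u \<in> unit_sphere n"
  shows "radial (gauge_body n q) u = (1 / q u) powr (1 / p)"
proof -
  have uR: "u \<in> Rn n" and qu: "0 < q u"
    using u by (auto simp: unit_sphere_def intro!: gauge_pos[OF G])
  have iff: "vscale l u \<in> gauge_body n q \<longleftrightarrow> l \<le> (1 / q u) powr (1 / p)" if l: "0 \<le> l" for l
  proof -
    have "vscale l u \<in> gauge_body n q \<longleftrightarrow> l powr p \<le> 1 / q u"
      using uR l qu by (simp add: gauge_body_def Rn_scale quasi_gauge.q_scale[OF G] field_simps)
    also have "\<dots> \<longleftrightarrow> l \<le> (1 / q u) powr (1 / p)"
      using powr_inverse_le_iff[of "1 / p" l "(1 / q u)"] quasi_gauge.p_pos[OF G] l qu by simp
    finally show ?thesis .
  qed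
  then have "{l. 0 \<le> l \<and> vscale l u \<in> gauge_body n q} = {0..(1 / q u) powr (1 / p)}"
    by auto
  then show ?thesis by (simp add: radial_def)
qed

lemma star_body_gauge_body:
  assumes G: "quasi_gauge n p \<alpha> \<beta> q"
  shows "star_body n (gauge_body n q)"
  unfolding star_body_def
proof (intro conjI ballI)
  show "body n (gauge_body n q)" by (rule body_gauge_body[OF G])
  show "star_shaped (gauge_body n q)"
    unfolding star_shaped_def
  proof (intro conjI ballI zero_in_gauge_body[OF G])
    fix x and t :: real assume x: "x \<in> gauge_body n q" and t: "t \<in> {0..1}"
    have "t powr p \<le> 1" using t quasi_gauge.p_pos[OF G] by (simp add: powr_le1)
    then have "t powr p * q x \<le> 1"
      using x gauge_nonneg[OF G, of x] by (auto simp: gauge_body_def intro: mult_le_one)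
    then show "vscale t x \<in> gauge_body n q"
      using x t by (simp add: gauge_body_def Rn_scale quasi_gauge.q_scale[OF G])
  qed
  have qu: "u \<in> Rn n \<and> 0 < q u" if "u \<in> unit_sphere n" for u
    using that by (auto simp: unit_sphere_def intro!: gauge_pos[OF G])
  show "0 < radial (gauge_body n q) u" if "u \<in> unit_sphere n" for u
    using qu[OF that] by (simp add: radial_gauge_body[OF G that])
  have "continuous_on (unit_sphere n) (\<lambda>u. (1 / q u) powr (1 / p))"
    using qu continuous_on_subset[OF continuous_on_gauge[OF G], of "unit_sphere n"]
    by (intro continuous_intros) (force simp: unit_sphere_def)+
  then have "continuous_on (unit_sphere n) (radial (gauge_body n q))"
    by (subst continuous_on_cong[OF refl radial_gauge_body[OF G]]) auto
  moreover have "{x. \<forall>i\<ge>n. x i = 0} \<inter> unit_sphere n = unit_sphere n"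
    by (auto simp: unit_sphere_def topspace_Euclidean_space)
  ultimately show "continuous_map (subtopology (Euclidean_space n) (unit_sphere n))
      euclideanreal (radial (gauge_body n q))"
    by (simp add: Euclidean_space_eq subtopology_subtopology)
qed

text \<open>The identity is an admissible map, with dilation factors \<open>\<alpha>\<close> and
  \<open>\<beta>\<close>.\<close>

lemma banach_mazur_gauge_body:
  assumes G: "quasi_gauge n p \<alpha> \<beta> q"
  shows "banach_mazur n (gauge_body n q) (unit_ball n) \<le> \<beta> / \<alpha>"
proof (rule banach_mazur_le[OF quasi_gauge.\<alpha>_pos[OF G] quasi_gauge.\<beta>_pos[OF G] id_in_GL])
  show "vscale \<alpha> ` gauge_body n q \<subseteq> (\<lambda>x. x) ` unit_ball n"
  proof
    fix y assume "y \<in> vscale \<alpha> ` gauge_body n q"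
    then obtain x where x: "x \<in> gauge_body n q" "y = vscale \<alpha> x" by blast
    then show "y \<in> (\<lambda>x. x) ` unit_ball n"
      using gauge_body_norm_le[OF G x(1)] quasi_gauge.\<alpha>_pos[OF G]
      by (simp add: unit_ball_def Rn_scale L2_set_vscale gauge_body_def field_simps)
  qed
  show "(\<lambda>x. x) ` unit_ball n \<subseteq> vscale \<beta> ` gauge_body n q"
  proof
    fix x assume "x \<in> (\<lambda>x. x) ` unit_ball n"
    then have x: "x \<in> Rn n" "L2_set x {..<n} \<le> 1" by (auto simp: unit_ball_def)
    have "q x \<le> (\<beta> * L2_set x {..<n}) powr p" by (rule quasi_gauge.q_le[OF G x(1)])
    also have "\<dots> \<le> \<beta> powr p"
      using x quasi_gauge.\<beta>_pos[OF G] quasi_gauge.p_pos[OF G] by (intro powr_mono2) (auto simp: mult_left_le)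
    finally show "x \<in> vscale \<beta> ` gauge_body n q"
      using mem_vscale_gauge_body_iff[OF G x(1) quasi_gauge.\<beta>_pos[OF G]] by simp
  qed
qed

section \<open>Hyperplane sections of gauge bodies\<close>

lemma sets_section:
  assumes G: "quasi_gauge n p \<alpha> \<beta> q"
    and b: "perp_basis n u b"
  shows "{y \<in> space (leb (n - 1)). frame_map n b y \<in> gauge_body n q} \<in> sets (leb (n - 1))"
proof -
  have "frame_map n b \<in> leb (n - 1) \<rightarrow>\<^sub>M Pi\<^sub>M UNIV (\<lambda>_. borel)"
    unfolding frame_map_def by (rule measurable_PiM_single') auto
  \<comment> \<open>The index set is countable, so the product sigma-algebra is the Borel one, and
    closedness of the body yields measurability of the section.\<close>
  then have f: "frame_map n b \<in> leb (n - 1) \<rightarrow>\<^sub>M borel"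
    by (simp cong: measurable_cong_sets add: sets_PiM_equal_borel)
  have "gauge_body n q \<in> sets borel" using closed_gauge_body[OF G] by (rule borel_closed)
  from measurable_sets[OF f this] show ?thesis
    by (simp add: vimage_def Int_def conj_commute)
qed

lemma section_subset_lball:
  assumes G: "quasi_gauge n p \<alpha> \<beta> q"
    and b: "perp_basis n u b"
  shows "{y \<in> space (leb (n - 1)). frame_map n b y \<in> gauge_body n q} \<subseteq> lball (n - 1) (1 / \<alpha>)"
  unfolding lball_def L2_frame_map[OF b, symmetric]
  by (auto intro!: power_mono gauge_body_norm_le[OF G])

lemma section_fmeasurable:
  assumes G: "quasi_gauge n p \<alpha> \<beta> q"
    and b: "perp_basis n u b"
  shows "{y \<in> space (leb (n - 1)). frame_map n b y \<in> gauge_body n q} \<in> fmeasurable (leb (n - 1))"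
  using lball_fmeasurable section_subset_lball[OF G b] sets_section[OF G b] by (rule fmeasurableI2)

text \<open>\<open>frame_map\<close> is isometric, so the two Euclidean balls around and inside the
  body cut out balls in the coordinates of the section.\<close>

lemma section_bounds:
  assumes G: "quasi_gauge n p \<alpha> \<beta> q"
    and u: "u \<in> unit_sphere n"
  defines "V \<equiv> measure (leb (n - 1)) (lball (n - 1) 1)"
  shows "(1 / \<beta>) ^ (n - 1) * V \<le> section_volume n (gauge_body n q) u"
    and "section_volume n (gauge_body n q) u \<le> (1 / \<alpha>) ^ (n - 1) * V"
proof -
  let ?m = "n - 1"
  obtain b where b: "perp_basis n u b"
    and S: "section_volume n (gauge_body n q) u = measure (leb ?m) {y \<in> space (leb ?m). frame_map n b y \<in> gauge_body n q}"
    (is "_ = measure _ ?S")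
    by (rule section_volume_frame[OF u])
  have "lball ?m (1 / \<beta>) \<subseteq> ?S"
  proof
    fix y assume y: "y \<in> lball ?m (1 / \<beta>)"
    then have "(L2_set (frame_map n b y) {..<n})\<^sup>2 \<le> (1 / \<beta>)\<^sup>2"
      by (simp add: L2_frame_map[OF b] lball_def)
    then have "L2_set (frame_map n b y) {..<n} \<le> 1 / \<beta>"
      by (rule power2_le_imp_le) (use quasi_gauge.\<beta>_pos[OF G] in simp)
    with y show "y \<in> ?S"
      by (auto simp: lball_def intro!: gauge_bodyI[OF G] frame_map_in_Rn[OF b])
  qed
  then have "measure (leb ?m) (lball ?m (1 / \<beta>)) \<le> section_volume n (gauge_body n q) u"
    unfolding S by (rule measure_mono_fmeasurable[OF _ sets_lball section_fmeasurable[OF G b]])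
  then show "(1 / \<beta>) ^ ?m * V \<le> section_volume n (gauge_body n q) u"
    using measure_lball[of "1 / \<beta>" ?m] quasi_gauge.\<beta>_pos[OF G] by (simp add: V_def)
  have "section_volume n (gauge_body n q) u \<le> measure (leb ?m) (lball ?m (1 / \<alpha>))"
    unfolding S
    by (rule measure_mono_fmeasurable[OF section_subset_lball[OF G b] sets_section[OF G b] lball_fmeasurable])
  then show "section_volume n (gauge_body n q) u \<le> (1 / \<alpha>) ^ ?m * V"
    using measure_lball[of "1 / \<alpha>" ?m] quasi_gauge.\<alpha>_pos[OF G] by (simp add: V_def)
qed

text \<open>Shows that the infimum defining the distance of the intersection body runs over a
  nonempty set; a lower bound for its elements then passes to the infimum.\<close>

lemma intersection_body_sandwich:
  assumes G: "quasi_gauge n p \<alpha> \<beta> q"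
  shows "\<exists>a b T. 0 < a \<and> 0 < b \<and> T \<in> GL n \<and>
    vscale a ` intersection_body n (gauge_body n q) \<subseteq> T ` unit_ball n \<and>
    T ` unit_ball n \<subseteq> vscale b ` intersection_body n (gauge_body n q)"
proof -
  define V where "V = measure (leb (n - 1)) (lball (n - 1) 1)"
  define s where "s = (1 / \<beta>) ^ (n - 1) * V"
  define t where "t = (1 / \<alpha>) ^ (n - 1) * V"
  have V: "0 < V" unfolding V_def by (rule measure_lball_pos)
  have s: "0 < s" and t: "0 < t"
    using V quasi_gauge.\<alpha>_pos[OF G] quasi_gauge.\<beta>_pos[OF G] by (auto simp: s_def t_def)
  note bounds = section_bounds[OF G, folded V_def, folded s_def t_def]
  have "vscale (1 / t) ` intersection_body n (gauge_body n q) \<subseteq> (\<lambda>x. x) ` unit_ball n"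
  proof
    fix y assume "y \<in> vscale (1 / t) ` intersection_body n (gauge_body n q)"
    then obtain r u where y: "y = vscale (1 / t) (vscale r u)" "u \<in> unit_sphere n" "0 \<le> r"
      "r \<le> section_volume n (gauge_body n q) u"
      by (auto simp: intersection_body_def)
    then have "r \<le> t" using bounds(2)[of u] by simp
    then show "y \<in> (\<lambda>x. x) ` unit_ball n"
      using y t by (auto simp: unit_ball_def unit_sphere_def Rn_scale L2_set_vscale)
  qed
  moreover have "(\<lambda>x. x) ` unit_ball n \<subseteq> vscale (1 / s) ` intersection_body n (gauge_body n q)"
  proof
    fix x assume "x \<in> (\<lambda>x. x) ` unit_ball n"
    then have x: "x \<in> Rn n" "L2_set x {..<n} \<le> 1" by (auto simp: unit_ball_def)
    have "\<exists>u\<in>unit_sphere n. x = vscale (L2_set x {..<n}) u"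
    proof (cases "L2_set x {..<n} = 0")
      case True
      then have "x = (\<lambda>i. 0)"
        using x(1) by (intro Rn_eq_zero)
      with True show ?thesis
        using unit_vec_in_sphere[OF quasi_gauge.n_pos[OF G]] by (auto simp: vscale_def)
    next
      case False
      then show ?thesis using unit_sphere_normalize[OF x(1)] by metis
    qed
    then obtain u where u: "u \<in> unit_sphere n" "x = vscale (L2_set x {..<n}) u" by blast
    have "s * L2_set x {..<n} \<le> s"
      using x(2) s by (intro mult_left_le) auto
    then have "s * L2_set x {..<n} \<le> section_volume n (gauge_body n q) u"
      using bounds(1)[OF u(1)] by linarith
    then have "vscale (s * L2_set x {..<n}) u \<in> intersection_body n (gauge_body n q)"
      using u(1) s unfolding intersection_body_def mem_Collect_eq
      by (intro exI[of _ "s * L2_set x {..<n}"] exI[of _ u]) simp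
    moreover have "x = vscale (1 / s) (vscale (s * L2_set x {..<n}) u)"
      using s u(2) by (simp add: vscale_vscale)
    ultimately show "x \<in> vscale (1 / s) ` intersection_body n (gauge_body n q)" by blast
  qed
  ultimately show ?thesis
    using s t id_in_GL[of n] by (intro exI[of _ "1 / t"] exI[of _ "1 / s"] exI[of _ "\<lambda>x. x"]) auto
qed

section \<open>The \<open>p\<close>-convex hull of four discs and its intersection body\<close>

text \<open>Divided by the sum \<open>s\<close>, both terms lie in \<open>[0, 1]\<close>, where a
  number is at most its \<open>p\<close>-th power.\<close>

lemma add_powr_le:
  fixes a b p :: real
  assumes "0 \<le> a" "0 \<le> b" "0 < p" "p \<le> 1"
  shows "(a + b) powr p \<le> a powr p + b powr p"
proof (cases "a + b = 0")
  case True
  then show ?thesis using assms by auto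
next
  case False
  define s where "s = a + b"
  have s: "0 < s" using False assms by (simp add: s_def)
  have *: "x * s powr p / s \<le> x powr p" if "0 \<le> x" "x \<le> s" for x
  proof -
    have "(x / s) powr 1 \<le> (x / s) powr p"
      using that s assms by (intro powr_mono') auto
    then have "x / s \<le> x powr p / s powr p"
      using that s by (simp add: powr_divide)
    then show ?thesis
      using s by (simp add: field_simps)
  qed
  have "s powr p = a * s powr p / s + b * s powr p / s"
    using s by (simp add: s_def flip: add_divide_distrib distrib_right)
  also have "\<dots> \<le> a powr p + b powr p"
    using *[of a] *[of b] assms by (simp add: s_def)
  finally show ?thesis by (simp add: s_def)
qed

text \<open>
  The numbers \<open>a, b, c, d\<close> are the weights of the discs centred at \<open>e\<^sub>1, - e\<^sub>1, e\<^sub>2, - e\<^sub>2\<close>, whose axes are the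
  coordinates \<open>0\<close> and \<open>1\<close> of \<open>x\<close>; the remaining part of \<open>x\<close> can be reached if and only if its norm is
  at most the total weight.
\<close>

definition split_costs :: "real \<Rightarrow> nat \<Rightarrow> (nat \<Rightarrow> real) \<Rightarrow> real set" where
  "split_costs p n x = {a powr p + b powr p + c powr p + d powr p | a b c d.
     0 \<le> a \<and> 0 \<le> b \<and> 0 \<le> c \<and> 0 \<le> d \<and> a - b = x 0 \<and> c - d = x 1 \<and>
     L2_set x {2..<n} \<le> a + b + c + d}"

text \<open>Costs are \<open>p\<close>-th powers of weights because the combinations forming a
  \<open>p\<close>-convex hull have weights whose \<open>p\<close>-th powers sum to at most 1. The
  infimum is the \<open>p\<close>-th power of the Minkowski functional of the hull.\<close>

definition cross_gauge :: "real \<Rightarrow> nat \<Rightarrow> (nat \<Rightarrow> real) \<Rightarrow> real" where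
  "cross_gauge p n x = Inf (split_costs p n x)"

lemma split_costsI:
  assumes "0 \<le> a" "0 \<le> b" "0 \<le> c" "0 \<le> d" "a - b = x 0" "c - d = x 1"
    "L2_set x {2..<n} \<le> a + b + c + d"
  shows "a powr p + b powr p + c powr p + d powr p \<in> split_costs p n x"
  unfolding split_costs_def using assms by blast

lemma split_costsE:
  assumes "s \<in> split_costs p n x"
  obtains a b c d where "s = a powr p + b powr p + c powr p + d powr p"
    "0 \<le> a" "0 \<le> b" "0 \<le> c" "0 \<le> d" "a - b = x 0" "c - d = x 1"
    "L2_set x {2..<n} \<le> a + b + c + d"
  using assms unfolding split_costs_def by blast

lemma split_costs_nonneg: "s \<in> split_costs p n x \<Longrightarrow> 0 \<le> s"
  by (auto simp: split_costs_def)

lemma cross_gauge_le: "s \<in> split_costs p n x \<Longrightarrow> cross_gauge p n x \<le> s"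
  unfolding cross_gauge_def
  by (rule cInf_lower) (auto intro!: bdd_belowI[of _ 0] split_costs_nonneg)

lemma split_costs_add:
  assumes "0 < p" "p \<le> 1" "s \<in> split_costs p n x" "t \<in> split_costs p n y"
  shows "\<exists>r\<in>split_costs p n (vadd x y). r \<le> s + t"
proof -
  obtain a b c d where x: "s = a powr p + b powr p + c powr p + d powr p"
    "0 \<le> a" "0 \<le> b" "0 \<le> c" "0 \<le> d" "a - b = x 0" "c - d = x 1" "L2_set x {2..<n} \<le> a + b + c + d"
    using assms(3) by (rule split_costsE)
  obtain a' b' c' d' where y: "t = a' powr p + b' powr p + c' powr p + d' powr p"
    "0 \<le> a'" "0 \<le> b'" "0 \<le> c'" "0 \<le> d'" "a' - b' = y 0" "c' - d' = y 1"
    "L2_set y {2..<n} \<le> a' + b' + c' + d'"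
    using assms(4) by (rule split_costsE)
  have "L2_set (vadd x y) {2..<n} \<le> L2_set x {2..<n} + L2_set y {2..<n}"
    unfolding vadd_def by (rule L2_set_triangle_ineq)
  then have "(a + a') powr p + (b + b') powr p + (c + c') powr p + (d + d') powr p
      \<in> split_costs p n (vadd x y)"
    using x y by (intro split_costsI) (simp_all add: vadd_def)
  moreover have "(a + a') powr p + (b + b') powr p + (c + c') powr p + (d + d') powr p \<le> s + t"
    using add_powr_le[of a a' p] add_powr_le[of b b' p] add_powr_le[of c c' p]
      add_powr_le[of d d' p] x y assms(1,2) by linarith
  ultimately show ?thesis by blast
qed

lemma split_costs_scale:
  assumes "0 \<le> t" "s \<in> split_costs p n x"
  shows "t powr p * s \<in> split_costs p n (vscale t x)"
proof -
  obtain a b c d where x: "s = a powr p + b powr p + c powr p + d powr p"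
    "0 \<le> a" "0 \<le> b" "0 \<le> c" "0 \<le> d" "a - b = x 0" "c - d = x 1" "L2_set x {2..<n} \<le> a + b + c + d"
    using assms(2) by (rule split_costsE)
  have "t * L2_set x {2..<n} \<le> t * (a + b + c + d)"
    using x assms by (intro mult_left_mono) auto
  then have "L2_set (vscale t x) {2..<n} \<le> t * a + t * b + t * c + t * d"
    using assms(1) L2_set_right_distrib[of t x "{2..<n}"] by (simp add: vscale_def algebra_simps)
  moreover have "t * a - t * b = t * x 0" "t * c - t * d = t * x 1"
    using x by (simp_all flip: right_diff_distrib)
  moreover have "t powr p * s = (t * a) powr p + (t * b) powr p + (t * c) powr p + (t * d) powr p"
    using x assms(1) by (simp add: powr_mult distrib_left)
  ultimately show ?thesis
    using x assms(1) by (simp only:) (intro split_costsI, simp_all add: vscale_def)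
qed

lemma L2_set_split2:
  fixes n :: nat
  assumes "2 \<le> n"
  shows "(L2_set x {..<n})\<^sup>2 = (x 0)\<^sup>2 + (x 1)\<^sup>2 + (L2_set x {2..<n})\<^sup>2"
proof -
  have "{..<n} = {0, 1} \<union> {2..<n}" using assms by auto
  then show ?thesis
    by (simp add: L2_set_def sum_nonneg)
qed

lemma split_costs_small:
  assumes n: "2 \<le> n" and p: "0 < p"
  shows "\<exists>s\<in>split_costs p n x. s \<le> 4 * 2 powr p * L2_set x {..<n} powr p"
proof -
  define r where "r = L2_set x {..<n}"
  have r: "0 \<le> r" by (simp add: r_def)
  have sq: "\<bar>w\<bar> \<le> r" if "w\<^sup>2 \<le> r\<^sup>2" for w
    using that r by (simp flip: abs_le_square_iff)
  have x0: "\<bar>x 0\<bar> \<le> r" and x1: "\<bar>x 1\<bar> \<le> r" and z: "\<bar>L2_set x {2..<n}\<bar> \<le> r"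
    by (rule sq, use L2_set_split2[OF n, of x] in \<open>simp add: r_def\<close>)+
  \<comment> \<open>Positive and negative parts produce the coordinates 0 and 1. Adding
    \<open>r\<close> to both \<open>a\<close> and \<open>b\<close> keeps their difference and makes
    the total weight large enough for the remaining part; no weight exceeds
    \<open>2 * r\<close>.\<close>
  define a b c d where "a = max 0 (x 0) + r" and "b = max 0 (- x 0) + r"
    and "c = max 0 (x 1)" and "d = max 0 (- x 1)"
  have ab: "0 \<le> a" "0 \<le> b" "0 \<le> c" "0 \<le> d" "a \<le> 2 * r" "b \<le> 2 * r" "c \<le> 2 * r" "d \<le> 2 * r"
    using x0 x1 r by (auto simp: a_def b_def c_def d_def)
  have "a - b = x 0" "c - d = x 1" "L2_set x {2..<n} \<le> a + b + c + d"
    using z r by (auto simp: a_def b_def c_def d_def)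
  with ab have "a powr p + b powr p + c powr p + d powr p \<in> split_costs p n x"
    by (intro split_costsI)
  moreover have "a powr p + b powr p + c powr p + d powr p \<le> 4 * (2 * r) powr p"
    using powr_mono2[of p a "2 * r"] powr_mono2[of p b "2 * r"] powr_mono2[of p c "2 * r"]
      powr_mono2[of p d "2 * r"] ab p by simp
  moreover have "4 * (2 * r) powr p = 4 * 2 powr p * r powr p"
    using r by (simp add: powr_mult)
  ultimately show ?thesis
    unfolding r_def by metis
qed

lemma split_costs_nonempty: "2 \<le> n \<Longrightarrow> 0 < p \<Longrightarrow> split_costs p n x \<noteq> {}"
  using split_costs_small by blast

text \<open>The total weight \<open>S\<close> dominates both axis coordinates and the remaining
  norm, so the squared norm is at most three, hence four, times the square of \<open>S\<close>. By
  subadditivity of the power the cost is at least \<open>S powr p\<close>.\<close>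

lemma split_costs_ge:
  assumes n: "2 \<le> n" and p: "0 < p" "p \<le> 1" and s: "s \<in> split_costs p n x"
  shows "2 powr - p * L2_set x {..<n} powr p \<le> s"
proof -
  obtain a b c d where x: "s = a powr p + b powr p + c powr p + d powr p"
    "0 \<le> a" "0 \<le> b" "0 \<le> c" "0 \<le> d" "a - b = x 0" "c - d = x 1" "L2_set x {2..<n} \<le> a + b + c + d"
    using s by (rule split_costsE)
  let ?S = "a + b + c + d"
  have "(x 0)\<^sup>2 \<le> ?S\<^sup>2" "(x 1)\<^sup>2 \<le> ?S\<^sup>2" "(L2_set x {2..<n})\<^sup>2 \<le> ?S\<^sup>2"
    using x by (auto simp flip: abs_le_square_iff)
  moreover have "(2 * ?S)\<^sup>2 = ?S\<^sup>2 + ?S\<^sup>2 + ?S\<^sup>2 + ?S\<^sup>2"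
    by (simp only: power_mult_distrib) simp
  ultimately have "(L2_set x {..<n})\<^sup>2 \<le> (2 * ?S)\<^sup>2"
    using L2_set_split2[OF n, of x] zero_le_power2[of ?S] by linarith
  then have "L2_set x {..<n} \<le> 2 * ?S"
    by (rule power2_le_imp_le) (use x in simp)
  then have "L2_set x {..<n} powr p \<le> (2 * ?S) powr p"
    using p by (intro powr_mono2) auto
  also have "\<dots> = 2 powr p * ?S powr p"
    using x by (intro powr_mult)
  also have "?S powr p \<le> s"
    using add_powr_le[of "a + b + c" d p] add_powr_le[of "a + b" c p] add_powr_le[of a b p] x p by simp
  finally show ?thesis
    by (simp add: powr_minus field_simps)
qed

text \<open>
  The two sums \<open>a + c\<close> and \<open>b + d\<close> agree, so each of them is at least half of the norm.
\<close>

lemma split_costs_antidiagonal: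
  assumes p: "0 < p" "p \<le> 1" and s: "s \<in> split_costs p n x" and eq: "x 1 = - x 0"
  shows "2 * (L2_set x {2..<n} / 2) powr p \<le> s"
proof -
  obtain a b c d where x: "s = a powr p + b powr p + c powr p + d powr p"
    "0 \<le> a" "0 \<le> b" "0 \<le> c" "0 \<le> d" "a - b = x 0" "c - d = x 1" "L2_set x {2..<n} \<le> a + b + c + d"
    using s by (rule split_costsE)
  have ac: "a + c = b + d" using x eq by simp
  have "(L2_set x {2..<n} / 2) powr p \<le> (a + c) powr p"
    using p x ac by (intro powr_mono2) auto
  moreover have "(a + c) powr p \<le> a powr p + c powr p" "(a + c) powr p \<le> b powr p + d powr p"
    using add_powr_le[of a c p] add_powr_le[of b d p] p x ac by auto
  ultimately show ?thesis using x(1) by simp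
qed

lemma le_cross_gauge:
  assumes "2 \<le> n" "0 < p" "\<And>s. s \<in> split_costs p n x \<Longrightarrow> t \<le> s"
  shows "t \<le> cross_gauge p n x"
  unfolding cross_gauge_def by (rule cInf_greatest) (use assms split_costs_nonempty in auto)

text \<open>The two discs on one axis suffice: the positive and negative parts of \<open>t\<close>
  have total weight \<open>\<bar>t\<bar>\<close>, and one of them is 0. This is the cone contained
  in the axis sections.\<close>

lemma cross_gauge_axis:
  assumes p: "0 < p" and t: "\<bar>t\<bar> \<le> 1" and z: "L2_set x {2..<n} \<le> \<bar>t\<bar>"
    and x: "x 0 = t \<and> x 1 = 0 \<or> x 0 = 0 \<and> x 1 = t"
  shows "cross_gauge p n x \<le> 1"
proof -
  have *: "max 0 t powr p + max 0 (- t) powr p = \<bar>t\<bar> powr p"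
    using p by (simp add: max_def)
  have diff: "max 0 t - max 0 (- t) = t" and sum: "max 0 t + max 0 (- t) = \<bar>t\<bar>"
    by (simp_all add: max_def)
  have "\<bar>t\<bar> powr p \<in> split_costs p n x"
    using x
  proof (elim disjE conjE)
    assume "x 0 = t" "x 1 = 0"
    then show ?thesis
      using split_costsI[of "max 0 t" "max 0 (- t)" 0 0 x n p] z diff sum * by simp
  next
    assume "x 0 = 0" "x 1 = t"
    then show ?thesis
      using split_costsI[of 0 0 "max 0 t" "max 0 (- t)" x n p] z diff sum * by simp
  qed
  then have "cross_gauge p n x \<le> \<bar>t\<bar> powr p"
    by (rule cross_gauge_le)
  moreover have "\<bar>t\<bar> powr p \<le> 1"
    using t p by (simp add: powr_le1)
  ultimately show ?thesis by linarith
qed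

section \<open>The diagonal direction and ellipsoids\<close>

definition diag_vec :: "nat \<Rightarrow> real" where
  "diag_vec = (\<lambda>j. if j < 2 then 1 / sqrt 2 else 0)"

lemma sum_split2:
  fixes f :: "nat \<Rightarrow> real"
  assumes "2 \<le> n"
  shows "(\<Sum>j<n. f j) = f 0 + f 1 + (\<Sum>j=2..<n. f j)"
proof -
  have "{..<n} = {0, 1} \<union> {2..<n}" using assms by auto
  then show ?thesis by simp
qed

lemma diag_vec_in_sphere:
  assumes "2 \<le> n"
  shows "diag_vec \<in> unit_sphere n"
  using assms
  by (simp add: unit_sphere_def topspace_Euclidean_space diag_vec_def L2_set_def sum_split2 power_divide)

text \<open>
  An ellipsoid squeezed between two dilates of the intersection body contains the
  midpoint of its points on the first two axes, which lies on the diagonal.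
\<close>

lemma sandwich_diagonal:
  assumes n: "2 \<le> n" and a: "0 < a" and b: "0 < b" and T: "T \<in> GL n"
    and sub1: "vscale a ` intersection_body n K \<subseteq> T ` unit_ball n"
    and sub2: "T ` unit_ball n \<subseteq> vscale b ` intersection_body n K"
    and A: "0 < A" "A \<le> section_volume n K (unit_vec 0)" "A \<le> section_volume n K (unit_vec 1)"
  shows "a * A \<le> sqrt 2 * (b * section_volume n K diag_vec)"
proof -
  have img: "vscale a (vscale A (unit_vec i)) \<in> T ` unit_ball n" if i: "i \<in> {0, 1}" for i
  proof -
    have "vscale A (unit_vec i) \<in> intersection_body n K"
      using i A n unit_vec_in_sphere[of i n] unfolding intersection_body_def mem_Collect_eq
      by (intro exI[of _ A] exI[of _ "unit_vec i"]) auto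
    with sub1 show ?thesis by blast
  qed
  obtain v where v: "v \<in> unit_ball n" "vscale a (vscale A (unit_vec 0)) = T v"
    using img[of 0] by blast
  obtain w where w: "w \<in> unit_ball n" "vscale a (vscale A (unit_vec 1)) = T w"
    using img[of 1] by blast
  let ?x = "vscale (1 / 2) (vadd v w)"
  have vw: "v \<in> Rn n" "w \<in> Rn n" using v w by (auto simp: unit_ball_def)
  have "L2_set (vadd v w) {..<n} \<le> 2"
    using L2_set_triangle_ineq[of v w "{..<n}"] v w by (simp add: unit_ball_def vadd_def)
  then have "?x \<in> unit_ball n"
    using vw by (simp add: unit_ball_def Rn_add Rn_scale L2_set_vscale)
  then have "T ?x \<in> vscale b ` intersection_body n K"
    using sub2 by blast
  moreover have "T ?x = vscale (1 / 2) (vadd (T v) (T w))"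
    using T vw by (simp add: GL_def Rn_add)
  \<comment> \<open>Half the sum of the two axis vectors is \<open>diag_vec\<close> divided by
    \<open>sqrt 2\<close>; this is the source of the factor \<open>sqrt 2\<close> in the
    conclusion.\<close>
  moreover have "\<dots> = vscale (a * A / sqrt 2) diag_vec"
    unfolding v(2)[symmetric] w(2)[symmetric]
    by (auto simp: vscale_def vadd_def unit_vec_def diag_vec_def fun_eq_iff less_2_cases_iff)
  ultimately obtain r u where ru: "vscale (a * A / sqrt 2) diag_vec = vscale b (vscale r u)"
    "u \<in> unit_sphere n" "0 \<le> r" "r \<le> section_volume n K u"
    by (auto simp: intersection_body_def)
  have pos: "0 < a * A / sqrt 2" using a A by simp
  have "a * A / sqrt 2 = L2_set (vscale (a * A / sqrt 2) diag_vec) {..<n}"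
    using diag_vec_in_sphere[OF n] pos by (subst L2_set_vscale) (auto simp: unit_sphere_def)
  also have "\<dots> = b * r"
    unfolding ru(1) using ru(2,3) b by (simp add: L2_set_vscale unit_sphere_def)
  finally have eq: "a * A / sqrt 2 = b * r" .
  have "vscale (b * r) diag_vec = vscale (b * r) u"
    using ru(1) by (simp add: eq vscale_vscale)
  then have "diag_vec = u"
    using pos unfolding eq by (auto simp: vscale_def fun_eq_iff)
  with ru(4) have "b * r \<le> b * section_volume n K diag_vec"
    using b by simp
  with eq have "a * A / sqrt 2 \<le> b * section_volume n K diag_vec" by simp
  then show ?thesis by (simp add: pos_divide_le_eq mult.commute mult.left_commute)
qed

section \<open>Gauge properties of the hull\<close>

lemma cross_gauge_add:
  assumes n_ge: "2 \<le> n" and p: "0 < p" "p \<le> 1"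
  shows "cross_gauge p n (vadd x y) \<le> cross_gauge p n x + cross_gauge p n y"
proof -
  have *: "cross_gauge p n (vadd x y) \<le> s + t"
    if "s \<in> split_costs p n x" "t \<in> split_costs p n y" for s t
    using split_costs_add[OF p that] cross_gauge_le[of _ p n "vadd x y"] by force
  have "cross_gauge p n (vadd x y) - cross_gauge p n x \<le> cross_gauge p n y"
  proof (rule le_cross_gauge[OF n_ge p(1)])
    fix t assume t: "t \<in> split_costs p n y"
    have "cross_gauge p n (vadd x y) - t \<le> cross_gauge p n x"
      by (rule le_cross_gauge[OF n_ge p(1)]) (use *[OF _ t] in \<open>simp add: algebra_simps\<close>)
    then show "cross_gauge p n (vadd x y) - cross_gauge p n x \<le> t" by simp
  qed
  then show ?thesis by simp
qed

lemma cross_gauge_nonneg: "2 \<le> n \<Longrightarrow> 0 < p \<Longrightarrow> 0 \<le> cross_gauge p n x"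
  by (rule le_cross_gauge) (auto intro: split_costs_nonneg)

lemma cross_gauge_scale:
  assumes n_ge: "2 \<le> n" and p: "0 < p" and t: "0 \<le> t"
  shows "cross_gauge p n (vscale t x) = t powr p * cross_gauge p n x"
proof (cases "t = 0")
  case True
  \<comment> \<open>For \<open>t = 0\<close> any split will do, since scaling it gives cost
    \<open>0 powr p * s = 0\<close>.\<close>
  obtain s where "s \<in> split_costs p n x"
    using split_costs_nonempty[OF n_ge p] by blast
  then have "cross_gauge p n (vscale t x) \<le> t powr p * s"
    using t by (intro cross_gauge_le split_costs_scale)
  then show ?thesis
    using True cross_gauge_nonneg[OF n_ge p, of "vscale t x"] by simp
next
  case False
  have le: "cross_gauge p n (vscale t x) \<le> t powr p * cross_gauge p n x" if t: "0 < t" for t x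
  proof -
    have "cross_gauge p n (vscale t x) / t powr p \<le> cross_gauge p n x"
    proof (rule le_cross_gauge[OF n_ge p])
      fix s assume "s \<in> split_costs p n x"
      then have "cross_gauge p n (vscale t x) \<le> t powr p * s"
        using t by (intro cross_gauge_le split_costs_scale) auto
      then show "cross_gauge p n (vscale t x) / t powr p \<le> s"
        using t by (simp add: field_simps)
    qed
    then show ?thesis using t by (simp add: field_simps)
  qed
  have t: "0 < t" using False t by simp
  have "cross_gauge p n x \<le> (1 / t) powr p * cross_gauge p n (vscale t x)"
    using le[of "1 / t" "vscale t x"] t by (simp add: vscale_vscale vscale_one)
  then show ?thesis
    using le[OF t, of x] t by (simp add: powr_divide field_simps)
qed

text \<open>Both constants are free of \<open>n\<close>, so the distance of the body from the ball
  stays bounded as \<open>n\<close> grows. The factor \<open>4 powr (1 / p)\<close> accounts for the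
  four weights in \<open>split_costs_small\<close>.\<close>

lemma quasi_gauge_cross_gauge:
  assumes n_ge: "2 \<le> n" and p: "0 < p" "p \<le> 1"
  shows "quasi_gauge n p (1 / 2) (2 * 4 powr (1 / p)) (cross_gauge p n)"
proof
  fix x y :: "nat \<Rightarrow> real" and t :: real
  show "0 < n" "0 < p" "0 < (1 / 2 :: real)" "0 < 2 * 4 powr (1 / p)"
    using n_ge p by auto
  show "cross_gauge p n (vadd x y) \<le> cross_gauge p n x + cross_gauge p n y"
    by (rule cross_gauge_add[OF n_ge p])
  show "0 \<le> t \<Longrightarrow> cross_gauge p n (vscale t x) = t powr p * cross_gauge p n x"
    by (rule cross_gauge_scale[OF n_ge p(1)])
  have "2 powr - p * L2_set x {..<n} powr p \<le> cross_gauge p n x"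
    by (rule le_cross_gauge[OF n_ge p(1)]) (rule split_costs_ge[OF n_ge p])
  then show "(1 / 2 * L2_set x {..<n}) powr p \<le> cross_gauge p n x"
    by (simp add: powr_divide powr_minus field_simps)
  obtain s where "s \<in> split_costs p n x" "s \<le> 4 * 2 powr p * L2_set x {..<n} powr p"
    using split_costs_small[OF n_ge p(1), of x] by blast
  then have "cross_gauge p n x \<le> 4 * 2 powr p * L2_set x {..<n} powr p"
    using cross_gauge_le by (meson order_trans)
  then show "cross_gauge p n x \<le> (2 * 4 powr (1 / p) * L2_set x {..<n}) powr p"
    using p by (simp add: powr_mult powr_powr)
qed

abbreviation cross_body :: "real \<Rightarrow> nat \<Rightarrow> (nat \<Rightarrow> real) set" where
  "cross_body p n \<equiv> gauge_body n (cross_gauge p n)"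

section \<open>Large axis sections and small diagonal sections\<close>

lemma section_axis_ge:
  fixes N :: nat
  assumes n_ge: "2 \<le> n" and p: "0 < p" "p \<le> 1"
    and k: "k \<in> {0, 1}" and N: "2 \<le> N"
  shows "(1 - 1 / N) ^ (n - 1) * measure (leb (n - 1)) (lball (n - 1) 1)
    \<le> (2 * N + 1) * section_volume n (cross_body p n) (unit_vec k)"
proof -
  note gauge = quasi_gauge_cross_gauge[OF n_ge p]
  have kn: "k < n" "1 - k < n" using k n_ge by auto
  have u: "unit_vec k \<in> unit_sphere n"
    by (rule unit_vec_in_sphere[OF kn(1)])
  obtain b where b: "perp_basis n (unit_vec k) b"
    and S: "section_volume n (cross_body p n) (unit_vec k) =
      measure (leb (n - 1)) {y \<in> space (leb (n - 1)). frame_map n b y \<in> cross_body p n}"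
    by (rule section_volume_frame[OF u])
  \<comment> \<open>\<open>1 - k\<close> is the index of the other axis, and \<open>g\<close>
    represents that coordinate in the frame; it is a unit vector because \<open>unit_vec k\<close>
    vanishes there. The slab along \<open>g\<close> lies in the cone, as
    \<open>1 - 1 / N \<le> t\<close>.\<close>
  define g where "g i = b i (1 - k)" for i
  have g: "(\<Sum>i<n - 1. (g i)\<^sup>2) = 1"
    using perp_basis_column[OF u b kn(2)] k by (auto simp: g_def unit_vec_def)
  note slab = measure_slab_ge[OF g N]
  define C where "C = {y \<in> space (leb (n - 1)). 1 - 1 / N \<le> (\<Sum>i<n - 1. y i * g i) \<and>
      (\<Sum>i<n - 1. y i * g i) \<le> 1 \<and>
      (\<Sum>i<n - 1. (y i)\<^sup>2) - (\<Sum>i<n - 1. y i * g i)\<^sup>2 \<le> (1 - 1 / N)\<^sup>2}"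
  have "C \<subseteq> {y \<in> space (leb (n - 1)). frame_map n b y \<in> cross_body p n}"
  proof
    fix y assume y: "y \<in> C"
    define t where "t = (\<Sum>i<n - 1. y i * g i)"
    let ?Y = "frame_map n b y"
    have t: "1 - 1 / N \<le> t" "t \<le> 1" and yt: "(\<Sum>i<n - 1. (y i)\<^sup>2) - t\<^sup>2 \<le> (1 - 1 / N)\<^sup>2"
      using y by (auto simp: C_def t_def)
    have N1: "0 \<le> 1 - 1 / real N" using N by simp
    have Yt: "?Y (1 - k) = t"
      by (simp add: frame_map_def t_def g_def)
    have "(\<Sum>j<n. ?Y j * unit_vec k j) = (\<Sum>j<n. if j = k then ?Y k else 0)"
      by (intro sum.cong) (auto simp: unit_vec_def)
    then have Yk: "?Y k = 0"
      using dot_frame_map[OF b, of y] kn by (simp add: dot_def)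
    have Y: "?Y 0 = t \<and> ?Y 1 = 0 \<or> ?Y 0 = 0 \<and> ?Y 1 = t"
      using k Yt Yk by auto
    then have "(L2_set ?Y {2..<n})\<^sup>2 = (\<Sum>i<n - 1. (y i)\<^sup>2) - t\<^sup>2"
      using L2_set_split2[OF n_ge, of ?Y] L2_frame_map[OF b, of y] by auto
    also have "\<dots> \<le> t\<^sup>2"
      using yt power_mono[OF t(1) N1, of 2] by linarith
    finally have "L2_set ?Y {2..<n} \<le> \<bar>t\<bar>"
      using abs_le_square_iff[of "L2_set ?Y {2..<n}" t] by simp
    moreover have "\<bar>t\<bar> \<le> 1" using t N1 by simp
    ultimately have "cross_gauge p n ?Y \<le> 1"
      using cross_gauge_axis[OF p(1) _ _ Y] by blast
    then show "y \<in> {y \<in> space (leb (n - 1)). frame_map n b y \<in> cross_body p n}"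
      using y frame_map_in_Rn[OF b, of y] by (simp add: gauge_body_def C_def)
  qed
  then have "measure (leb (n - 1)) C \<le> section_volume n (cross_body p n) (unit_vec k)"
    unfolding S using slab(2)[folded C_def] section_fmeasurable[OF gauge b]
    by (rule measure_mono_fmeasurable)
  then have "(2 * N + 1) * measure (leb (n - 1)) C \<le> (2 * N + 1) * section_volume n (cross_body p n) (unit_vec k)"
    by (intro mult_left_mono) auto
  with slab(1)[folded C_def] show ?thesis by linarith
qed

text \<open>On this hyperplane coordinates 0 and 1 are opposite, so
  \<open>split_costs_antidiagonal\<close> confines the section to a thin cylinder around the
  antidiagonal.\<close>

lemma section_diag_le:
  fixes N :: nat
  assumes n_ge: "2 \<le> n" and p: "0 < p" "p \<le> 1"
    and N: "1 \<le> N"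
  shows "section_volume n (cross_body p n) diag_vec \<le> (4 * N + 1) *
    ((2 powr (1 - 1 / p) + 1 / N) ^ (n - 1) * measure (leb (n - 1)) (lball (n - 1) 1))"
proof -
  note gauge = quasi_gauge_cross_gauge[OF n_ge p]
  have u: "diag_vec \<in> unit_sphere n"
    by (rule diag_vec_in_sphere[OF n_ge])
  obtain b where b: "perp_basis n diag_vec b"
    and S: "section_volume n (cross_body p n) diag_vec =
      measure (leb (n - 1)) {y \<in> space (leb (n - 1)). frame_map n b y \<in> cross_body p n}"
    by (rule section_volume_frame[OF u])
  \<comment> \<open>Column 0 of the frame has squared norm \<open>1 - 1 / 2\<close>, so
    \<open>sqrt 2\<close> normalises it; \<open>g\<close> is the antidiagonal direction in frame
    coordinates.\<close>
  define g where "g i = sqrt 2 * b i 0" for i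
  have g: "(\<Sum>i<n - 1. (g i)\<^sup>2) = 1"
    using perp_basis_column[OF u b, of 0] n_ge
    by (simp add: g_def power_mult_distrib diag_vec_def power_divide flip: sum_distrib_left)
  show ?thesis
    unfolding S
  proof (rule measure_cylinder_le[OF g N])
    show "0 < (2 powr (1 - 1 / p) :: real)" by simp
    fix y assume y: "y \<in> {y \<in> space (leb (n - 1)). frame_map n b y \<in> cross_body p n}"
    let ?Y = "frame_map n b y"
    let ?z = "L2_set ?Y {2..<n}"
    have YK: "?Y \<in> cross_body p n" using y by simp
    have yg: "(\<Sum>i<n - 1. y i * g i) = sqrt 2 * ?Y 0"
      by (simp add: frame_map_def g_def sum_distrib_left mult_ac)
    have "(?Y 0 + ?Y 1) / sqrt 2 = dot n ?Y diag_vec"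
      using n_ge by (simp add: dot_def sum_split2 diag_vec_def add_divide_distrib)
    then have Y1: "?Y 1 = - ?Y 0"
      using dot_frame_map[OF b, of y] by simp
    have sq: "(\<Sum>i<n - 1. (y i)\<^sup>2) = (sqrt 2 * ?Y 0)\<^sup>2 + ?z\<^sup>2"
      using L2_set_split2[OF n_ge, of ?Y] L2_frame_map[OF b, of y] Y1
      by (simp add: power_mult_distrib)
    have "2 * (?z / 2) powr p \<le> cross_gauge p n ?Y"
      by (rule le_cross_gauge[OF n_ge p(1)]) (rule split_costs_antidiagonal[OF p _ Y1])
    also have "\<dots> \<le> 1" using YK by (simp add: gauge_body_def)
    finally have "((?z / 2) powr p) powr (1 / p) \<le> (1 / 2) powr (1 / p)"
      using p by (intro powr_mono2) auto
    then have "?z / 2 \<le> 1 / 2 powr (1 / p)"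
      using p by (simp add: powr_powr powr_divide)
    then have z: "?z \<le> 2 powr (1 - 1 / p)"
      by (simp add: powr_diff)
    \<comment> \<open>The outer radius \<open>1 / \<alpha> = 2\<close> bounds the extent along the
      axis of the cylinder.\<close>
    have "(L2_set ?Y {..<n})\<^sup>2 \<le> 2\<^sup>2"
      using gauge_body_norm_le[OF gauge YK] by (intro power_mono) auto
    then have "(sqrt 2 * ?Y 0)\<^sup>2 \<le> 2\<^sup>2"
      using L2_frame_map[OF b, of y] sq zero_le_power2[of ?z] by linarith
    then have "\<bar>sqrt 2 * ?Y 0\<bar> \<le> \<bar>2\<bar>"
      by (simp only: abs_le_square_iff)
    moreover have "?z\<^sup>2 \<le> (2 powr (1 - 1 / p))\<^sup>2"
      using z by (intro power_mono) auto
    ultimately show "y \<in> space (leb (n - 1)) \<and> \<bar>\<Sum>i<n - 1. y i * g i\<bar> \<le> 2 \<and>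
        (\<Sum>i<n - 1. (y i)\<^sup>2) - (\<Sum>i<n - 1. y i * g i)\<^sup>2 \<le> (2 powr (1 - 1 / p))\<^sup>2"
      using y unfolding yg sq by simp
  qed
qed

text \<open>\<open>sandwich_diagonal\<close> bounds every admissible ratio from below by the axis
  sections over the diagonal one; the volume of the unit ball cancels from this quotient.\<close>

lemma banach_mazur_intersection_body_ge:
  fixes N :: nat
  assumes n_ge: "2 \<le> n" and p: "0 < p" "p \<le> 1"
    and N: "2 \<le> N"
  shows "((1 - 1 / N) / (2 powr (1 - 1 / p) + 1 / N)) ^ (n - 1) / (sqrt 2 * (2 * N + 1) * (4 * N + 1))
    \<le> banach_mazur n (intersection_body n (cross_body p n)) (unit_ball n)"
proof -
  note gauge = quasi_gauge_cross_gauge[OF n_ge p]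
  define V where "V = measure (leb (n - 1)) (lball (n - 1) 1)"
  define A where "A = (1 - 1 / N) ^ (n - 1) * V / (2 * N + 1)"
  define l where "l = 2 powr (1 - 1 / p) + 1 / N"
  define D where "D = (4 * N + 1) * (l ^ (n - 1) * V)"
  have V: "0 < V" unfolding V_def by (rule measure_lball_pos)
  have l: "0 < l" using N by (simp add: l_def add_pos_nonneg)
  have N1: "0 < 1 - 1 / real N" using N by simp
  have A: "0 < A" using V N1 by (simp add: A_def)
  have D: "0 < D" using V l by (simp add: D_def)
  have Ale: "A \<le> section_volume n (cross_body p n) (unit_vec k)" if "k \<in> {0, 1}" for k
    using section_axis_ge[OF n_ge p that N] unfolding V_def[symmetric]
    by (simp add: A_def pos_divide_le_eq mult.commute)
  have Dge: "section_volume n (cross_body p n) diag_vec \<le> D"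
    using section_diag_le[OF n_ge p, of N] N by (simp add: D_def l_def V_def)
  have "((1 - 1 / N) / l) ^ (n - 1) / (sqrt 2 * (2 * N + 1) * (4 * N + 1)) = A / (sqrt 2 * D)"
    using V l by (simp add: A_def D_def power_divide)
  also have "\<dots> \<le> banach_mazur n (intersection_body n (cross_body p n)) (unit_ball n)"
    unfolding banach_mazur_def
  proof (rule cInf_greatest)
    show "{b / a |a b. 0 < a \<and> 0 < b \<and> (\<exists>T\<in>GL n. vscale a ` intersection_body n (cross_body p n) \<subseteq> T ` unit_ball n \<and>
        T ` unit_ball n \<subseteq> vscale b ` intersection_body n (cross_body p n))} \<noteq> {}"
      using intersection_body_sandwich[OF gauge] by blast
  next
    fix d assume "d \<in> {b / a |a b. 0 < a \<and> 0 < b \<and>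
      (\<exists>T\<in>GL n. vscale a ` intersection_body n (cross_body p n) \<subseteq> T ` unit_ball n \<and>
        T ` unit_ball n \<subseteq> vscale b ` intersection_body n (cross_body p n))}"
    then obtain a b T where d: "d = b / a" and ab: "0 < a" "0 < b" and T: "T \<in> GL n"
      "vscale a ` intersection_body n (cross_body p n) \<subseteq> T ` unit_ball n"
      "T ` unit_ball n \<subseteq> vscale b ` intersection_body n (cross_body p n)"
      by blast
    have "a * A \<le> sqrt 2 * (b * section_volume n (cross_body p n) diag_vec)"
      by (rule sandwich_diagonal[OF n_ge ab T A]) (auto intro: Ale)
    also have "\<dots> \<le> sqrt 2 * (b * D)"
      using Dge ab by (intro mult_left_mono) auto
    finally show "A / (sqrt 2 * D) \<le> d"
      using D ab by (simp add: d field_simps)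
  qed
  finally show ?thesis by (simp add: l_def)
qed

section \<open>Choice of the constants\<close>

theorem theorem5:
  fixes p c :: real
  assumes "0 < p" and "p < 1"
    and "1 < c" and "c < 2 powr (1 / p - 1)"
  shows "\<exists>N. \<forall>n\<ge>N. \<exists>K. p_convex n p K \<and> star_body n K \<and>
           c ^ n * banach_mazur n K (unit_ball n)
             < banach_mazur n (intersection_body n K) (unit_ball n)"
proof -
  define \<mu> where "\<mu> = 2 powr (1 - 1 / p)"
  have \<mu>: "0 < \<mu>" by (simp add: \<mu>_def)
  have "c * \<mu> < 2 powr (1 / p - 1) * \<mu>"
    using assms(4) \<mu> by simp
  also have "\<dots> = 1"
    by (simp add: \<mu>_def flip: powr_add)
  finally have "0 < (1 - c * \<mu>) / (1 + c)"
    using assms(3) by simp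
  \<comment> \<open>The bound on \<open>1 / N\<close> is the inequality
    \<open>c * (\<mu> + 1 / N) < 1 - 1 / N\<close> solved for \<open>1 / N\<close>; it makes the
    growth rate \<open>\<theta>\<close> exceed \<open>c\<close>.\<close>
  then obtain M :: nat where M: "inverse (real (Suc M)) < (1 - c * \<mu>) / (1 + c)"
    using reals_Archimedean by blast
  define N where "N = Suc (Suc M)"
  have N2: "2 \<le> N" by (simp add: N_def)
  have "1 / real N \<le> inverse (real (Suc M))"
    by (simp add: N_def field_simps)
  with M have "1 / real N < (1 - c * \<mu>) / (1 + c)" by linarith
  then have "1 / real N * (1 + c) < 1 - c * \<mu>"
    using assms(3) by (simp add: pos_less_divide_eq)
  then have *: "c * (\<mu> + 1 / real N) < 1 - 1 / real N"
    by (simp add: algebra_simps add_divide_distrib)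
  define l where "l = \<mu> + 1 / real N"
  define \<theta> where "\<theta> = (1 - 1 / real N) / l"
  have l: "0 < l" using \<mu> by (simp add: l_def add_pos_nonneg)
  have \<theta>: "c < \<theta>"
    using * l by (simp add: \<theta>_def l_def[symmetric] pos_less_divide_eq)
  \<comment> \<open>\<open>B\<close> is the quotient \<open>\<beta> / \<alpha>\<close> for the hull,
    and \<open>E\<close> collects the slab counts and the factor \<open>sqrt 2\<close>.\<close>
  define B where "B = 2 * 4 powr (1 / p) / (1 / 2)"
  define E where "E = sqrt 2 * (2 * N + 1) * (4 * N + 1)"
  have E: "0 < E" by (simp add: E_def)
  have "1 < \<theta> / c" using \<theta> assms(3) by simp
  \<comment> \<open>The extra factor \<open>c\<close> pays for the exponent: the distance grows like
    \<open>\<theta> ^ (n - 1)\<close> but is compared with \<open>c ^ n\<close>.\<close>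
  then obtain m where m: "c * B * E < (\<theta> / c) ^ m"
    using real_arch_pow by blast
  show ?thesis
  \<comment> \<open>From \<open>m + 2\<close> on, both \<open>2 \<le> n\<close> and
    \<open>m \<le> n - 1\<close> hold.\<close>
  proof (rule exI[of _ "m + 2"], intro allI impI)
    fix n assume n: "m + 2 \<le> n"
    define K where "K = cross_body p n"
    have n2: "2 \<le> n" and p1: "p \<le> 1" using n assms by auto
    note gauge = quasi_gauge_cross_gauge[OF n2 assms(1) p1]
    have cn: "c ^ n = c * c ^ (n - 1)"
      using n by (cases n) auto
    have "(\<theta> / c) ^ m \<le> (\<theta> / c) ^ (n - 1)"
      using n \<open>1 < \<theta> / c\<close> by (intro power_increasing) auto
    with m have "c * B * E < (\<theta> / c) ^ (n - 1)" by linarith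
    then have "c * B * E * c ^ (n - 1) < \<theta> ^ (n - 1)"
      using assms(3) by (simp add: power_divide pos_less_divide_eq)
    then have "c ^ n * B < \<theta> ^ (n - 1) / E"
      using E by (simp add: cn pos_less_divide_eq mult_ac)
    moreover have "c ^ n * banach_mazur n K (unit_ball n) \<le> c ^ n * B"
      using banach_mazur_gauge_body[OF gauge] assms(3)
      by (intro mult_left_mono) (auto simp: B_def K_def)
    moreover have "\<theta> ^ (n - 1) / E \<le> banach_mazur n (intersection_body n K) (unit_ball n)"
      using banach_mazur_intersection_body_ge[OF n2 assms(1) p1 N2]
      by (simp add: \<theta>_def l_def \<mu>_def E_def K_def)
    ultimately show "\<exists>K. p_convex n p K \<and> star_body n K \<and>
        c ^ n * banach_mazur n K (unit_ball n)
          < banach_mazur n (intersection_body n K) (unit_ball n)"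
      using p_convex_gauge_body[OF gauge] star_body_gauge_body[OF gauge]
      by (intro exI[of _ K]) (auto simp: K_def)
  qed
qed

end
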